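(* Let the coefficients $Y_j$, $j\ge0$, be defined by $Y_0=4$ and recursively, for $j\ge1$, $$Y_j=-\alpha_j-18\sum_{\ell=0}^jn_{j+1-\ell}\frac{t_\ell}{5^\ell}+\sum_{\ell=0}^{j-1}Y_\ell\Big(\Big(\frac32-\frac{5^{\ell-j}}{2}\Big)n_{j-\ell+1}+\sum_{k=0}^{j-\ell}\big(5\alpha_{j+1-\ell-k}n_k5^{-k}-3n_{j+1-\ell-k}\alpha_k5^{-k}\big)\Big).$$ Then every polynomial $u$ on $SG$ satisfies the matching condition $$\partial_Tu(q_{01})+\partial_Tu(q_{10})=\sum_{\ell=0}^\infty Y_\ell\,\partial_n\Delta^\ell u(q_{01}).$$
   Context: Let $q_0,q_1,q_2$ be the vertices of an equilateral triangle in the plane (indices mod 3), $F_i(x)=\frac12(x+q_i)$, and let $SG$ (Sierpinski gasket) be the unique nonempty compact set with $SG=\bigcup_{i=0}^2F_i(SG)$. For a word $w=(w_1,\dots,w_m)\in\{0,1,2\}^m$, $|w|=m$, put $F_w=F_{w_1}\circ\cdots\circ F_{w_m}$; $F_w(SG)$ is a cell of level $m$. $V_0=\{q_0,q_1,q_2\}$, $V_m=\bigcup_iF_i(V_{m-1})$, $V_*=\bigcup_mV_m$; for distinct $x,y\in V_m$, $x\sim_my$ means $x,y$ lie in a common cell of level $m$. Laplacian: $u\in\mathrm{dom}\,\Delta$ with $\Delta u=f$ means that $u,f$ are continuous on $SG$ and $\frac32 5^m\sum_{y\sim_mx}(u(y)-u(x))\to f(x)$ as $m\to\infty$, uniformly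 for $x\in V_*\setminus V_0$. Powers $\Delta^n$ are defined iteratively. $\mathcal H_j$ is the space of solutions of $\Delta^{j+1}u=0$; a polynomial is an element of some $\mathcal H_j$. Normal derivative: $\partial_nu(q_j)=\lim_{m\to\infty}(5/3)^m\big(2u(q_j)-u(F_j^mq_{j+1})-u(F_j^mq_{j-1})\big)$. Tangential derivative: $\partial_Tu(q_j)=\lim_{m\to\infty}5^m\big(u(F_j^mq_{j+1})-u(F_j^mq_{j-1})\big)$. With respect to a cell $F_w(SG)$: $\partial_nu(F_wq_j)=(5/3)^{|w|}\partial_n(u\circ F_w)(q_j)$ and $\partial_Tu(F_wq_j)=5^{|w|}\partial_T(u\circ F_w)(q_j)$. The junction point $F_0q_1=F_1q_0$ is written $q_{01}=F_0q_1$ when derivatives are taken with respect to the cell $F_0(SG)$, and $q_{10}=F_1q_0$ when derivatives are taken with respect to the cell $F_1(SG)$. The monomial $P_{jk}$ ($k=1,2,3$, $j\ge0$) is the unique function in $\mathcal H_j$ such that for all $0\le m\le j$: $\Delta^mP_{jk}(q_0)=\delta_{mj}\delta_{k1}$, $\partial_n\Delta^mP_{jk}(q_0)=\delta_{mj}\delta_{k2}$, $\partial_T\Delta^mP_{jk}(q_0)=\delta_{mj}\delta_{k3}$. Constants: $\alpha_j=P_{j1}(q_1)$, $n_j=\partial_nP_{j1}(q_1)$, $t_j=\partial_TP_{j2}(q_1)$. *)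

theory Defs
  imports "HOL-Analysis.Analysis"
begin

text \<open>
  The index set of the vertices is the numeral type \<open>3\<close>, whose arithmetic is modulo 3; so
  \<open>j + 1\<close> and \<open>j - 1\<close> are the cyclic neighbours of \<open>j\<close>.  Everything is parametrised by the
  vertex family \<open>q\<close>.
\<close>

definition equilateral :: "(3 \<Rightarrow> real^2) \<Rightarrow> bool" where
  "equilateral q \<longleftrightarrow> (\<exists>r>0. \<forall>i j. i \<noteq> j \<longrightarrow> dist (q i) (q j) = r)"

definition contr :: "(3 \<Rightarrow> real^2) \<Rightarrow> 3 \<Rightarrow> real^2 \<Rightarrow> real^2" where
  "contr q i x = (1/2) *\<^sub>R (x + q i)"

primrec word_contr :: "(3 \<Rightarrow> real^2) \<Rightarrow> 3 list \<Rightarrow> real^2 \<Rightarrow> real^2" where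
  "word_contr q [] = id"
| "word_contr q (i # w) = contr q i \<circ> word_contr q w"

definition gasket :: "(3 \<Rightarrow> real^2) \<Rightarrow> (real^2) set" where
  "gasket q = (THE K. K \<noteq> {} \<and> compact K \<and> K = (\<Union>i. contr q i ` K))"

primrec vertices :: "(3 \<Rightarrow> real^2) \<Rightarrow> nat \<Rightarrow> (real^2) set" where
  "vertices q 0 = range q"
| "vertices q (Suc m) = (\<Union>i. contr q i ` vertices q m)"

definition adjacent :: "(3 \<Rightarrow> real^2) \<Rightarrow> nat \<Rightarrow> real^2 \<Rightarrow> real^2 \<Rightarrow> bool" where
  "adjacent q m x y \<longleftrightarrow> x \<in> vertices q m \<and> y \<in> vertices q m \<and> x \<noteq> y \<and>
     (\<exists>w. length w = m \<and> x \<in> word_contr q w ` gasket q \<and> y \<in> word_contr q w ` gasket q)"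

definition graph_laplacian :: "(3 \<Rightarrow> real^2) \<Rightarrow> nat \<Rightarrow> (real^2 \<Rightarrow> real) \<Rightarrow> real^2 \<Rightarrow> real" where
  "graph_laplacian q m u x = 3/2 * 5^m * (\<Sum>y | adjacent q m x y. u y - u x)"

text \<open>
  Functions on the gasket are represented by functions on the whole plane, of which only the
  values on the gasket matter.  Where a function on the gasket is selected by a definite
  description, the value 0 off the gasket is prescribed to make the representative unique.
\<close>

text \<open>
  The difference expression of level \<open>m\<close> at \<open>x\<close> makes sense only once \<open>x\<close> belongs to
  \<open>vertices q m\<close>; the uniform limit over the non-boundary vertices is therefore taken over
  those vertices already present at level \<open>m\<close>, with a threshold \<open>M\<close> not depending on \<open>x\<close>.
\<close>

definition has_laplacian ::
    "(3 \<Rightarrow> real^2) \<Rightarrow> (real^2 \<Rightarrow> real) \<Rightarrow> (real^2 \<Rightarrow> real) \<Rightarrow> bool" where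
  "has_laplacian q u f \<longleftrightarrow> continuous_on (gasket q) u \<and> continuous_on (gasket q) f \<and>
     (\<forall>e>0. \<exists>M. \<forall>m\<ge>M. \<forall>x \<in> vertices q m - vertices q 0.
        \<bar>graph_laplacian q m u x - f x\<bar> < e)"

definition dom_laplacian :: "(3 \<Rightarrow> real^2) \<Rightarrow> (real^2 \<Rightarrow> real) set" where
  "dom_laplacian q = {u. \<exists>f. has_laplacian q u f}"

definition laplacian :: "(3 \<Rightarrow> real^2) \<Rightarrow> (real^2 \<Rightarrow> real) \<Rightarrow> real^2 \<Rightarrow> real" where
  "laplacian q u = (THE f. has_laplacian q u f \<and> (\<forall>x. x \<notin> gasket q \<longrightarrow> f x = 0))"

definition polyharmonic :: "(3 \<Rightarrow> real^2) \<Rightarrow> nat \<Rightarrow> (real^2 \<Rightarrow> real) set" where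
  "polyharmonic q j = {u. (\<forall>i\<le>j. (laplacian q ^^ i) u \<in> dom_laplacian q) \<and>
     (\<forall>x \<in> gasket q. (laplacian q ^^ Suc j) u x = 0)}"

definition is_polynomial :: "(3 \<Rightarrow> real^2) \<Rightarrow> (real^2 \<Rightarrow> real) \<Rightarrow> bool" where
  "is_polynomial q u \<longleftrightarrow> (\<exists>j. u \<in> polyharmonic q j)"

definition has_normal_deriv ::
    "(3 \<Rightarrow> real^2) \<Rightarrow> (real^2 \<Rightarrow> real) \<Rightarrow> 3 \<Rightarrow> real \<Rightarrow> bool" where
  "has_normal_deriv q u j d \<longleftrightarrow>
     (\<lambda>m. (5/3)^m * (2 * u (q j) - u ((contr q j ^^ m) (q (j + 1)))
                               - u ((contr q j ^^ m) (q (j - 1))))) \<longlonglongrightarrow> d"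

definition has_tangential_deriv ::
    "(3 \<Rightarrow> real^2) \<Rightarrow> (real^2 \<Rightarrow> real) \<Rightarrow> 3 \<Rightarrow> real \<Rightarrow> bool" where
  "has_tangential_deriv q u j d \<longleftrightarrow>
     (\<lambda>m. 5^m * (u ((contr q j ^^ m) (q (j + 1))) - u ((contr q j ^^ m) (q (j - 1))))) \<longlonglongrightarrow> d"

definition normal_deriv :: "(3 \<Rightarrow> real^2) \<Rightarrow> (real^2 \<Rightarrow> real) \<Rightarrow> 3 \<Rightarrow> real" where
  "normal_deriv q u j = (THE d. has_normal_deriv q u j d)"

definition tangential_deriv :: "(3 \<Rightarrow> real^2) \<Rightarrow> (real^2 \<Rightarrow> real) \<Rightarrow> 3 \<Rightarrow> real" where
  "tangential_deriv q u j = (THE d. has_tangential_deriv q u j d)"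

text \<open>Derivatives at the vertex \<open>word_contr q w (q j)\<close> with respect to the cell of the word \<open>w\<close>:\<close>

definition cell_normal_deriv ::
    "(3 \<Rightarrow> real^2) \<Rightarrow> (real^2 \<Rightarrow> real) \<Rightarrow> 3 list \<Rightarrow> 3 \<Rightarrow> real" where
  "cell_normal_deriv q u w j = (5/3)^length w * normal_deriv q (u \<circ> word_contr q w) j"

definition cell_tangential_deriv ::
    "(3 \<Rightarrow> real^2) \<Rightarrow> (real^2 \<Rightarrow> real) \<Rightarrow> 3 list \<Rightarrow> 3 \<Rightarrow> real" where
  "cell_tangential_deriv q u w j = 5^length w * tangential_deriv q (u \<circ> word_contr q w) j"

text \<open>The monomials; the second index \<open>k\<close> ranges over 1, 2, 3.\<close>

definition monomial :: "(3 \<Rightarrow> real^2) \<Rightarrow> nat \<Rightarrow> nat \<Rightarrow> real^2 \<Rightarrow> real" where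
  "monomial q j k = (THE u. u \<in> polyharmonic q j \<and> (\<forall>x. x \<notin> gasket q \<longrightarrow> u x = 0) \<and>
     (\<forall>m\<le>j. (laplacian q ^^ m) u (q 0) = of_bool (m = j \<and> k = 1) \<and>
        has_normal_deriv q ((laplacian q ^^ m) u) 0 (of_bool (m = j \<and> k = 2)) \<and>
        has_tangential_deriv q ((laplacian q ^^ m) u) 0 (of_bool (m = j \<and> k = 3))))"

definition alpha :: "(3 \<Rightarrow> real^2) \<Rightarrow> nat \<Rightarrow> real" where
  "alpha q j = monomial q j 1 (q 1)"

definition nconst :: "(3 \<Rightarrow> real^2) \<Rightarrow> nat \<Rightarrow> real" where
  "nconst q j = normal_deriv q (monomial q j 1) 1"

definition tconst :: "(3 \<Rightarrow> real^2) \<Rightarrow> nat \<Rightarrow> real" where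
  "tconst q j = tangential_deriv q (monomial q j 2) 1"

end

theory Submission
  imports Defs
begin

unbundle no vec_syntax
unbundle fps_syntax

text \<open>
  A sequence of functions \<open>u\<^sub>0, u\<^sub>1, \<dots>\<close> with \<open>\<Delta> u\<^sub>0 = 0\<close> and \<open>\<Delta> u\<^sub>n\<^sub>+\<^sub>1 = u\<^sub>n\<close> is a formal eigenfunction
  \<open>u = (\<Sum>n. u\<^sub>n \<lambda>^n)\<close> with \<open>\<Delta> u = \<lambda> u\<close>, and the members of such sequences are exactly the polynomials.
  Spectral decimation holds formally: at level \<open>m\<close> the sum over the four neighbours of a vertex is
  \<open>4 \<alpha>(\<lambda>/5^m)\<close> times the value, where \<open>\<alpha>(\<lambda>) = (\<Sum>j. \<alpha>\<^sub>j \<lambda>^j)\<close> satisfies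
  \<open>\<alpha>(\<lambda>) = 4 \<alpha>(\<lambda>/5)\<^sup>2 - 3 \<alpha>(\<lambda>/5)\<close>.  So a formal eigenfunction is determined by three boundary
  values in the ring of power series, and the constants \<open>n\<^sub>j\<close> and \<open>t\<^sub>j\<close> have the generating functions
  \<open>n = E (\<alpha> - 1) (2 \<alpha> + 1)\<close> and \<open>t = - G / (2 E)\<close> with \<open>6 (\<alpha> - 1) G = \<lambda>\<close>.

  One subdivision step gives both sides of the matching condition as multiples of the difference of
  the boundary values at \<open>q\<^sub>0\<close> and \<open>q\<^sub>1\<close>, with quotient
  \<open>Y = 12 G' \<alpha>' / (E' (2 \<alpha>' + 1))\<close>, where a prime replaces \<open>\<lambda>\<close> by \<open>\<lambda>/5\<close>.  The recursion for
  \<open>Y\<^sub>j\<close> says that \<open>Y (3 n - 15 n' + 10 \<alpha> n' - 6 n \<alpha>') = \<lambda> (2 \<alpha> - 1) + 36 n t'\<close>, and both sides equal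
  \<open>- 8 \<lambda> \<alpha>'\<close>.
\<close>

section \<open>Power series in the eigenvalue\<close>

text \<open>
  The variable of a power series is the formal eigenvalue \<open>\<lambda>\<close>.  Composition with a map of level
  \<open>m\<close> divides it by \<open>5^m\<close>, which is the substitution \<open>dil ((1/5)^m)\<close>.
\<close>

definition dil :: "real \<Rightarrow> real fps \<Rightarrow> real fps" where
  "dil c f = Abs_fps (\<lambda>n. c ^ n * f $ n)"

lemma dil_nth [simp]: "dil c f $ n = c ^ n * f $ n"
  by (simp add: dil_def)

lemma dil_add [simp]: "dil c (f + g) = dil c f + dil c g"
  and dil_diff [simp]: "dil c (f - g) = dil c f - dil c g"
  and dil_minus [simp]: "dil c (- f) = - dil c f"
  and dil_0 [simp]: "dil c 0 = 0"
  and dil_1 [simp]: "dil c 1 = 1"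
  and dil_const [simp]: "dil c (fps_const d) = fps_const d"
  and dil_dil: "dil c (dil d f) = dil (c * d) f"
  and dil_one [simp]: "dil 1 f = f"
  and dil_X: "dil c fps_X = fps_const c * fps_X"
  by (auto simp: fps_eq_iff algebra_simps power_mult_distrib)

lemma dil_mult [simp]: "dil c (f * g) = dil c f * dil c g"
proof (rule fps_ext)
  fix n
  have "c ^ n * (f $ i * g $ (n - i)) = c ^ i * f $ i * (c ^ (n - i) * g $ (n - i))"
    if "i \<le> n" for i
    using that by (simp add: power_add [symmetric])
  then show "dil c (f * g) $ n = (dil c f * dil c g) $ n"
    unfolding dil_nth fps_mult_nth sum_distrib_left
    by (intro sum.cong) auto
qed

lemma dil_sum [simp]: "dil c (sum f S) = (\<Sum>i\<in>S. dil c (f i))"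
  by (induction S rule: infinite_finite_induct) auto

lemma dil_numeral [simp]: "dil c (numeral k) = numeral k"
  by (simp add: numeral_fps_const)

text \<open>Comparing coefficients of \<lambda>^n expresses (1 - 5^(-n)) times the n-th one through
  earlier ones, which is solvable for n > 0. At n = 0 the condition \<open>g $ 0 = 1\<close> leaves
  the value free, and it is normalised to 1.\<close>

lemma fps_functional_equation:
  fixes g :: "real fps"
  assumes "g $ 0 = 1"
  obtains f where "f $ 0 = 1" "f = g * dil (1/5) f"
proof -
  define R :: "(nat \<Rightarrow> real) \<Rightarrow> nat \<Rightarrow> real \<Rightarrow> bool" where
    "R = (\<lambda>e n r. r = (if n = 0 then 1
      else (\<Sum>m<n. g $ (n - m) * ((1/5) ^ m * e m)) / (1 - (1/5) ^ n)))"
  have "\<exists>e. \<forall>n. R e n (e n)"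
    by (rule dependent_wellorder_choice) (auto simp: R_def intro!: sum.cong)
  then obtain e where e: "\<And>n. R e n (e n)"
    by blast
  have "e n = (\<Sum>m\<le>n. g $ (n - m) * ((1/5) ^ m * e m))" for n
  proof (cases "n = 0")
    case True
    then show ?thesis using e [of 0] assms by (simp add: R_def)
  next
    case False
    have "((1/5) ^ n :: real) < 1"
      using False by (simp add: power_less_one_iff)
    then have "e n * (1 - (1/5) ^ n) = (\<Sum>m<n. g $ (n - m) * ((1/5) ^ m * e m))"
      using e [of n] False by (simp add: R_def)
    then have "e n = (\<Sum>m<n. g $ (n - m) * ((1/5) ^ m * e m)) + (1/5) ^ n * e n"
      by (simp add: algebra_simps)
    then show ?thesis
      using assms
      by (simp only: lessThan_Suc_atMost [symmetric] sum.lessThan_Suc diff_self_eq_0 mult_1)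
  qed
  moreover have "(\<Sum>m\<le>n. g $ (n - m) * ((1/5) ^ m * e m)) = (dil (1/5) (Abs_fps e) * g) $ n" for n
    unfolding fps_mult_nth dil_nth fps_nth_Abs_fps atMost_atLeast0
    by (intro sum.cong refl) (rule mult.commute)
  ultimately have "Abs_fps e = dil (1/5) (Abs_fps e) * g"
    by (intro fps_ext) (simp only: fps_nth_Abs_fps)
  moreover have "Abs_fps e $ 0 = 1"
    using e [of 0] by (simp add: R_def)
  ultimately show thesis
    by (intro that) (simp_all only: mult.commute)
qed

text \<open>For n > 0 the coefficients must satisfy (5^n - 5) e_n = 4 times the sum of e_m e_(n-m)
  over 0 < m < n. This is void at n = 1, where 1/6 is the value for which the factor 3/2 * 5^m * 4
  (\<alpha>(\<lambda>/5^m) - 1) arising from the graph Laplacian tends to \<lambda>.\<close>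

lemma alpha_series_exists:
  obtains a :: "real fps" where "a $ 0 = 1" "a $ 1 = 1/6"
    "a = 4 * (dil (1/5) a)\<^sup>2 - 3 * dil (1/5) a"
proof -
  define R :: "(nat \<Rightarrow> real) \<Rightarrow> nat \<Rightarrow> real \<Rightarrow> bool" where
    "R = (\<lambda>e n r. r = (if n = 0 then 1 else if n = 1 then 1/6
      else 4 / (5 ^ n - 5) * (\<Sum>m=1..<n. e m * e (n - m))))"
  have "\<exists>e. \<forall>n. R e n (e n)"
    by (rule dependent_wellorder_choice) (auto simp: R_def intro!: sum.cong)
  then obtain e where e: "\<And>n. R e n (e n)"
    by blast
  have e0: "e 0 = 1" and e1: "e 1 = 1/6"
    using e [of 0] e [of 1] by (simp_all add: R_def)
  have "e n = 4 * (\<Sum>m=0..n. ((1/5) ^ m * e m) * ((1/5) ^ (n - m) * e (n - m))) - 3 * ((1/5) ^ n * e n)" for n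
  proof -
    consider "n = 0" | "n = 1" | "n \<ge> 2" by linarith
    then show ?thesis
    proof cases
      case 3
      have "(5::real) ^ n \<ge> 5 ^ 2"
        using 3 by (intro power_increasing) auto
      then have n5: "(5::real) ^ n - 5 > 0" by simp
      have S: "(\<Sum>m=0..n. e m * e (n - m)) = 2 * e n + (\<Sum>m=1..<n. e m * e (n - m))"
      proof -
        have "{0..n} = insert 0 (insert n {1..<n})" using 3 by auto
        then show ?thesis using 3 e0 by simp
      qed
      have "(5 ^ n - 5) * e n = 4 * (\<Sum>m=1..<n. e m * e (n - m))"
        using e [of n] 3 n5 by (simp add: R_def)
      then have "5 ^ n * e n = 4 * (\<Sum>m=0..n. e m * e (n - m)) - 3 * e n"
        using S by (simp add: algebra_simps)
      then have "e n = (1/5) ^ n * (4 * (\<Sum>m=0..n. e m * e (n - m)) - 3 * e n)"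
        by (simp add: field_simps)
      moreover have "(\<Sum>m=0..n. ((1/5) ^ m * e m) * ((1/5) ^ (n - m) * e (n - m)))
          = (1/5) ^ n * (\<Sum>m=0..n. e m * e (n - m))"
        unfolding sum_distrib_left
        by (rule sum.cong) (auto simp: power_add [symmetric] field_simps)
      ultimately show ?thesis
        by (simp add: algebra_simps)
    qed (use e0 e1 in auto)
  qed
  then have "Abs_fps e = 4 * (dil (1/5) (Abs_fps e))\<^sup>2 - 3 * dil (1/5) (Abs_fps e)"
    by (intro fps_ext)
      (simp only: fps_sub_nth numeral_fps_const fps_mult_left_const_nth power2_eq_square fps_mult_nth [of "dil _ _"]
        dil_nth fps_nth_Abs_fps)
  then show thesis
    using that [of "Abs_fps e"] e0 e1 by simp
qed

section \<open>The decimation series and its normalising companions\<close>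

definition alpha_fps :: "real fps" where
  "alpha_fps = (SOME a. a $ 0 = 1 \<and> a $ 1 = 1/6 \<and> a = 4 * (dil (1/5) a)\<^sup>2 - 3 * dil (1/5) a)"

abbreviation "alpha_fps' \<equiv> dil (1/5) alpha_fps"

text \<open>
  \<open>ext_p\<close> and \<open>ext_q\<close> are the denominators of the decimation formula \<open>ext\<close> below.  \<open>normal_fps\<close> and \<open>tangential_fps\<close>
  normalise the boundary derivatives: with boundary values \<open>B\<close>, the normal derivative at \<open>q j\<close> is
  \<open>normal_fps * (2 * alpha_fps * B j - (B (j + 1) + B (j - 1)))\<close> and the tangential one is
  \<open>tangential_fps * (B (j + 1) - B (j - 1))\<close>.
\<close>

definition ext_p :: "real fps" where "ext_p = inverse (4 * alpha_fps' + 1)"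
definition ext_q :: "real fps" where "ext_q = inverse (2 * alpha_fps' - 1)"

lemma alpha_fps_0 [simp]: "alpha_fps $ 0 = 1"
  and alpha_fps_1 [simp]: "alpha_fps $ Suc 0 = 1/6"
  and alpha_fps_rec: "alpha_fps = 4 * alpha_fps'\<^sup>2 - 3 * alpha_fps'"
proof -
  have "alpha_fps $ 0 = 1 \<and> alpha_fps $ 1 = 1/6 \<and> alpha_fps = 4 * alpha_fps'\<^sup>2 - 3 * alpha_fps'"
    unfolding alpha_fps_def by (rule someI_ex) (metis alpha_series_exists)
  then show "alpha_fps $ 0 = 1" "alpha_fps $ Suc 0 = 1/6" "alpha_fps = 4 * alpha_fps'\<^sup>2 - 3 * alpha_fps'"
    by simp_all
qed

lemma ext_p: "(4 * alpha_fps' + 1) * ext_p = 1"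
  unfolding ext_p_def by (subst mult.commute, rule inverse_mult_eq_1) simp

lemma ext_q: "(2 * alpha_fps' - 1) * ext_q = 1"
  unfolding ext_q_def by (subst mult.commute, rule inverse_mult_eq_1) simp

lemma ext_p_0 [simp]: "ext_p $ 0 = 1/5"
  by (simp add: ext_p_def)

lemma ext_q_0 [simp]: "ext_q $ 0 = 1"
  by (simp add: ext_q_def)

definition normal_fps :: "real fps" where
  "normal_fps = (SOME e. e $ 0 = 1 \<and> e = (fps_const (5/3) * (2 * alpha_fps' + 1) * ext_p * ext_q) * dil (1/5) e)"

lemma normal_fps_0 [simp]: "normal_fps $ 0 = 1"
  and normal_fps_rec: "3 * normal_fps = 5 * (2 * alpha_fps' + 1) * ext_p * ext_q * dil (1/5) normal_fps"
proof -
  \<comment> \<open>The bracket has constant term 5/3 * 3 * 1/5 * 1 = 1, as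
    \<open>fps_functional_equation\<close> requires.\<close>
  have *: "normal_fps $ 0 = 1 \<and> normal_fps = (fps_const (5/3) * (2 * alpha_fps' + 1) * ext_p * ext_q) * dil (1/5) normal_fps"
    unfolding normal_fps_def by (rule someI_ex, rule fps_functional_equation) auto
  then show "normal_fps $ 0 = 1" by (rule conjunct1)
  have "3 * normal_fps = 3 * ((fps_const (5/3) * (2 * alpha_fps' + 1) * ext_p * ext_q) * dil (1/5) normal_fps)"
    by (rule arg_cong [OF conjunct2 [OF *]])
  also have "\<dots> = (3 * fps_const (5/3)) * (2 * alpha_fps' + 1) * ext_p * ext_q * dil (1/5) normal_fps"
    by (simp only: mult.assoc)
  also have "3 * fps_const (5/3) = (5 :: real fps)"
    by (simp add: numeral_fps_const)
  finally show "3 * normal_fps = 5 * (2 * alpha_fps' + 1) * ext_p * ext_q * dil (1/5) normal_fps" .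
qed

text \<open>The quotient (\<alpha> - 1)/\<lambda>, which unlike \<alpha> - 1 is a unit, so that it
  can be inverted in \<open>tangential_fps\<close>.\<close>

definition alpha_quot :: "real fps" where "alpha_quot = fps_shift 1 (alpha_fps - 1)"

lemma alpha_quot: "alpha_fps - 1 = fps_X * alpha_quot"
  by (rule fps_ext) (auto simp: alpha_quot_def fps_X_mult_nth)

lemma alpha_quot_0 [simp]: "alpha_quot $ 0 = 1/6"
  by (simp add: alpha_quot_def)

definition tangential_fps :: "real fps" where "tangential_fps = inverse (6 * alpha_quot)"

lemma tangential_fps_0 [simp]: "tangential_fps $ 0 = 1"
  by (simp add: tangential_fps_def)

lemma tangential_fps_alpha_fps: "6 * (alpha_fps - 1) * tangential_fps = fps_X"
proof -
  have "(6 * alpha_quot) * tangential_fps = 1"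
    unfolding tangential_fps_def by (subst mult.commute, rule inverse_mult_eq_1) simp
  then show ?thesis
    unfolding alpha_quot by (simp add: mult_ac)
qed

lemma tangential_fps_alpha_fps': "30 * (alpha_fps' - 1) * dil (1/5) tangential_fps = fps_X"
proof -
  have "dil (1/5) (6 * (alpha_fps - 1) * tangential_fps) = fps_const (1/5) * fps_X"
    by (simp only: tangential_fps_alpha_fps dil_X)
  then have "5 * (6 * (alpha_fps' - 1) * dil (1/5) tangential_fps) = 5 * fps_const (1/5) * fps_X"
    by simp
  also have "5 * fps_const (1/5) = (1 :: real fps)"
    by (simp add: numeral_fps_const)
  finally show ?thesis by (simp add: mult.assoc [symmetric])
qed

lemma alpha_fps'_minus_1_nz: "alpha_fps' - 1 \<noteq> 0"
  using tangential_fps_alpha_fps' by auto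

text \<open>The decimation polynomial factors as \<alpha> - 1 = (\<alpha>' - 1)(4 \<alpha>' + 1),
  with \<alpha>' for \<open>alpha_fps'\<close>; the common factor \<alpha>' - 1 is not a unit, but
  it is nonzero and power series form an integral domain.\<close>

lemma tangential_fps_rec: "tangential_fps = 5 * ext_p * dil (1/5) tangential_fps"
proof -
  have "6 * (alpha_fps' - 1) * (4 * alpha_fps' + 1) * tangential_fps = 6 * (alpha_fps' - 1) * (5 * dil (1/5) tangential_fps)"
  proof -
    have "alpha_fps - 1 = (alpha_fps' - 1) * (4 * alpha_fps' + 1)"
      using alpha_fps_rec by algebra
    then show ?thesis
      using tangential_fps_alpha_fps tangential_fps_alpha_fps' by algebra
  qed
  then have "(4 * alpha_fps' + 1) * tangential_fps = 5 * dil (1/5) tangential_fps"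
    using alpha_fps'_minus_1_nz by (simp add: mult.assoc)
  then show ?thesis
    using ext_p by algebra
qed

section \<open>Generating functions of the constants and the identity between them\<close>

definition n_fps :: "real fps" where "n_fps = normal_fps * (alpha_fps - 1) * (2 * alpha_fps + 1)"
definition t_fps :: "real fps" where "t_fps = fps_const (- 1/2) * tangential_fps * inverse normal_fps"
definition Y_fps :: "real fps" where
  "Y_fps = 12 * dil (1/5) tangential_fps * alpha_fps' * inverse (dil (1/5) normal_fps * (2 * alpha_fps' + 1))"

lemma t_fps: "2 * normal_fps * t_fps = - tangential_fps"
proof -
  have "normal_fps * inverse normal_fps = 1"
    by (subst mult.commute, rule inverse_mult_eq_1) simp
  moreover have "2 * fps_const (- 1/2) = (- 1 :: real fps)"
    by (simp add: numeral_fps_const)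
  ultimately show ?thesis
    unfolding t_fps_def by algebra
qed

lemma Y_fps: "dil (1/5) normal_fps * (2 * alpha_fps' + 1) * Y_fps = 12 * dil (1/5) tangential_fps * alpha_fps'"
proof -
  have "dil (1/5) normal_fps * (2 * alpha_fps' + 1) * inverse (dil (1/5) normal_fps * (2 * alpha_fps' + 1)) = 1"
    by (subst mult.commute, rule inverse_mult_eq_1) simp
  then show ?thesis
    unfolding Y_fps_def by algebra
qed

text \<open>Besides \<alpha> - 1 = (\<alpha>' - 1)(4 \<alpha>' + 1) one has 2 \<alpha> + 1 = (2
  \<alpha>' - 1)(4 \<alpha>' - 1), so the denominators \<open>ext_p\<close> and \<open>ext_q\<close>
  from \<open>normal_fps_rec\<close> cancel.\<close>

lemma n_fps_rec: "3 * n_fps = 5 * (4 * alpha_fps' - 1) * dil (1/5) n_fps"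
  unfolding n_fps_def dil_mult dil_add dil_diff dil_1 dil_numeral
  using normal_fps_rec ext_p ext_q alpha_fps_rec by algebra

text \<open>By \<open>n_fps_rec\<close> and the decimation equation the bracket on the left
  collapses to -20 \<open>dil (1/5) n_fps\<close>; its factor
  \<open>dil (1/5) normal_fps * (2 * alpha_fps' + 1)\<close> is the denominator of
  \<open>Y_fps\<close>, and its factor \<open>alpha_fps' - 1\<close> turns
  \<open>dil (1/5) tangential_fps\<close> into a multiple of \<lambda>.\<close>

lemma Y_fps_identity:
  "Y_fps * (3 * n_fps - 15 * dil (1/5) n_fps + 10 * alpha_fps * dil (1/5) n_fps - 6 * n_fps * alpha_fps')
     = fps_X * (2 * alpha_fps - 1) + 36 * n_fps * dil (1/5) t_fps" (is "?l = ?r")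
proof -
  have T: "2 * dil (1/5) normal_fps * dil (1/5) t_fps = - dil (1/5) tangential_fps"
    using arg_cong [OF t_fps, of "dil (1/5)"] by simp
  have N': "dil (1/5) n_fps = dil (1/5) normal_fps * (alpha_fps' - 1) * (2 * alpha_fps' + 1)"
    by (simp add: n_fps_def)
  have "3 * ?l = - 24 * fps_X * alpha_fps'"
    using N' n_fps_rec Y_fps tangential_fps_alpha_fps' alpha_fps_rec by algebra
  moreover have "3 * ?r = - 24 * fps_X * alpha_fps'"
    using N' T n_fps_rec tangential_fps_alpha_fps' alpha_fps_rec by algebra
  ultimately have "3 * ?l = 3 * ?r"
    by (rule trans [OF _ sym])
  then show ?thesis
    by (simp only: mult_cancel_left numeral_neq_fps_zero simp_thms)
qed

text \<open>Dilation by 5^(-m) makes every coefficient of \<open>H\<close> except the constant one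
  tend to 0, and a coefficient of a product is a finite sum. The limits defining the boundary
  derivatives are evaluated in this way.\<close>

lemma tendsto_mult_dil_nth: "(\<lambda>m. (F * dil ((1/5) ^ m) H) $ n) \<longlonglongrightarrow> F $ n * H $ 0"
proof -
  have *: "(\<lambda>m. F $ i * (((1/5) ^ m) ^ (n - i) * H $ (n - i))) \<longlonglongrightarrow> (if i = n then F $ n * H $ 0 else 0)"
    if "i \<in> {0..n}" for i
  proof (cases "i = n")
    case False
    then have "\<bar>(1/5) ^ (n - i)\<bar> < (1::real)"
      using that by (simp add: power_less_one_iff)
    then have "(\<lambda>m. ((1/5::real) ^ (n - i)) ^ m) \<longlonglongrightarrow> 0"
      by (intro LIMSEQ_power_zero) simp
    then have "(\<lambda>m. F $ i * (((1/5::real) ^ (n - i)) ^ m * H $ (n - i))) \<longlonglongrightarrow> F $ i * (0 * H $ (n - i))"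
      by (intro tendsto_mult tendsto_const)
    moreover have "((1/5::real) ^ (n - i)) ^ m = ((1/5) ^ m) ^ (n - i)" for m
      by (simp only: power_mult [symmetric] mult.commute)
    ultimately show ?thesis
      using False by simp
  qed simp
  have "(\<lambda>m. \<Sum>i=0..n. F $ i * (((1/5) ^ m) ^ (n - i) * H $ (n - i)))
      \<longlonglongrightarrow> (\<Sum>i=0..n. if i = n then F $ n * H $ 0 else 0)"
    by (intro tendsto_sum *)
  then show ?thesis
    by (simp add: fps_mult_nth)
qed

lemma dil_alpha_fps_minus_1:
  "dil ((1/5) ^ m) alpha_fps - 1 = fps_const ((1/5) ^ m) * (fps_X * dil ((1/5) ^ m) alpha_quot)"
proof -
  have "dil ((1/5) ^ m) (alpha_fps - 1) = dil ((1/5) ^ m) (fps_X * alpha_quot)"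
    by (simp only: alpha_quot)
  then show ?thesis
    by (simp only: dil_diff dil_mult dil_1 dil_X mult.assoc)
qed

text \<open>Membership in the ideal generated by \<lambda>^(n+1). A single polynomial fixes its
  boundary series only modulo such an ideal, so uniqueness is argued with truncations.\<close>

definition vanishes :: "nat \<Rightarrow> real fps \<Rightarrow> bool" where
  "vanishes n f \<longleftrightarrow> (\<forall>i\<le>n. f $ i = 0)"

lemma vanishes_add: "vanishes n f \<Longrightarrow> vanishes n g \<Longrightarrow> vanishes n (f + g)"
  and vanishes_diff: "vanishes n f \<Longrightarrow> vanishes n g \<Longrightarrow> vanishes n (f - g)"
  and vanishes_mult: "vanishes n f \<Longrightarrow> vanishes n (g * f)"
  by (simp_all add: vanishes_def fps_mult_nth)

lemma vanishes_mult': "vanishes n f \<Longrightarrow> vanishes n (f * g)"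
  using vanishes_mult [of n f g] by (simp only: mult.commute)

lemma vanishes_sum: "(\<And>k. k \<in> S \<Longrightarrow> vanishes n (f k)) \<Longrightarrow> vanishes n (sum f S)"
  by (simp add: vanishes_def fps_sum_nth)

lemma vanishes_unit_cancel:
  assumes "g $ 0 \<noteq> 0" "vanishes n (g * f)"
  shows "vanishes n f"
proof -
  have "inverse g * g = 1"
    using assms(1) by (rule inverse_mult_eq_1)
  then have "inverse g * (g * f) = f"
    by (simp add: mult.assoc [symmetric])
  then show ?thesis
    using vanishes_mult [OF assms(2), of "inverse g"] by (simp only:)
qed

section \<open>From the identity of series to the recursion of coefficients\<close>

lemma n_fps_0: "n_fps $ 0 = 0"
  by (simp add: n_fps_def)

lemma n_fps_1: "n_fps $ 1 = 1/2"
  by (simp add: n_fps_def fps_mult_nth_1)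

lemma Y_fps_0: "Y_fps $ 0 = 4"
  by (simp add: Y_fps_def)

text \<open>
  Half of the coefficients of \<open>Z_fps\<close> are the brackets in the recursion; the term \<open>l = j\<close>, absent there,
  contributes \<open>- 2 * Y j\<close> and is what the recursion is solved for.
\<close>

definition Z_fps :: "real fps" where
  "Z_fps = 3 * n_fps - 15 * dil (1/5) n_fps + 10 * (alpha_fps * dil (1/5) n_fps) - 6 * (n_fps * alpha_fps')"

lemma Z_fps_0: "Z_fps $ 0 = 0"
  by (simp add: Z_fps_def n_fps_0 numeral_fps_const)

lemma Z_fps_1: "Z_fps $ 1 = -2"
  using n_fps_1 by (simp add: Z_fps_def n_fps_0 numeral_fps_const fps_mult_nth_1)

text \<open>The convolution with \<open>alpha_fps\<close> has one more term than the sum in the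
  recursion, namely k = n + 1, which equals 5^(-n-1) n_(n+1). Together with the coefficient -15 it
  leaves -5^(-n) n_(n+1), half of which is the subtracted term. In the other convolution the extra
  term vanishes because n_0 = 0.\<close>

lemma Z_fps_nth:
  "Z_fps $ (n + 1) / 2 = (3/2 - (1/5) ^ n / 2) * n_fps $ (n + 1) +
    (\<Sum>k=0..n. 5 * alpha_fps $ (n + 1 - k) * n_fps $ k * (1/5) ^ k - 3 * n_fps $ (n + 1 - k) * alpha_fps $ k * (1/5) ^ k)"
proof -
  have 1: "(alpha_fps * dil (1/5) n_fps) $ (n + 1) = (\<Sum>k=0..n. alpha_fps $ (n + 1 - k) * n_fps $ k * (1/5) ^ k) + (1/5) ^ (n + 1) * n_fps $ (n + 1)"
  proof -
    have "(alpha_fps * dil (1/5) n_fps) $ (n + 1) = (dil (1/5) n_fps * alpha_fps) $ (n + 1)"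
      by (simp only: mult.commute)
    also have "\<dots> = (\<Sum>k=0..Suc n. alpha_fps $ (n + 1 - k) * n_fps $ k * (1/5) ^ k)"
      unfolding fps_mult_nth by (simp add: mult_ac)
    finally show ?thesis by simp
  qed
  have 2: "(n_fps * alpha_fps') $ (n + 1) = (\<Sum>k=0..n. n_fps $ (n + 1 - k) * alpha_fps $ k * (1/5) ^ k)"
  proof -
    have "(n_fps * alpha_fps') $ (n + 1) = (alpha_fps' * n_fps) $ (n + 1)"
      by (simp only: mult.commute)
    also have "\<dots> = (\<Sum>k=0..Suc n. n_fps $ (n + 1 - k) * alpha_fps $ k * (1/5) ^ k)"
      unfolding fps_mult_nth by (simp add: mult_ac)
    finally show ?thesis by (simp add: n_fps_0)
  qed
  have "Z_fps $ (n + 1) = 3 * n_fps $ (n + 1) - 15 * ((1/5) ^ (n + 1) * n_fps $ (n + 1)) +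
      10 * (alpha_fps * dil (1/5) n_fps) $ (n + 1) - 6 * (n_fps * alpha_fps') $ (n + 1)"
    unfolding Z_fps_def by (simp only: numeral_fps_const fps_mult_left_const_nth fps_add_nth fps_sub_nth dil_nth)
  moreover have "(\<Sum>k=0..n. 5 * alpha_fps $ (n + 1 - k) * n_fps $ k * (1/5) ^ k - 3 * n_fps $ (n + 1 - k) * alpha_fps $ k * (1/5) ^ k) =
      5 * (\<Sum>k=0..n. alpha_fps $ (n + 1 - k) * n_fps $ k * (1/5) ^ k) - 3 * (\<Sum>k=0..n. n_fps $ (n + 1 - k) * alpha_fps $ k * (1/5) ^ k)"
    by (simp only: sum_subtractf sum_distrib_left mult.assoc)
  moreover have "(1/5) ^ (n + 1) * n_fps $ (n + 1) = ((1/5) ^ n * n_fps $ (n + 1)) / 5"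
    by simp
  moreover have "(3/2 - (1/5) ^ n / 2) * n_fps $ (n + 1) = 3/2 * n_fps $ (n + 1) - ((1/5) ^ n * n_fps $ (n + 1)) / 2"
    by (simp add: algebra_simps)
  moreover have "z / 2 = e + S"
    if "z = 3 * N - 15 * b + 10 * (s + b) - 6 * t" "S = 5 * s - 3 * t" "b = a / 5" "e = 3/2 * N - a / 2"
    for z N b s t S a e :: real
    unfolding that by (simp add: field_simps)
  ultimately show ?thesis
    unfolding 1 2 by blast
qed

text \<open>This is the coefficient of \<lambda>^(j+1) in \<open>Y_fps_identity\<close>, halved:
  \<open>Z_fps $ 0 = 0\<close> removes \<open>Y_fps $ (j + 1)\<close>, and
  \<open>Z_fps $ 1 = -2\<close> isolates \<open>Y_fps $ j\<close>. For j = 0 the summand -1 in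
  \<open>2 * alpha_fps - 1\<close> would contribute as well.\<close>

lemma Y_fps_rec:
  assumes "j \<ge> 1"
  shows "Y_fps $ j = - alpha_fps $ j - 18 * (\<Sum>l=0..j. n_fps $ (j + 1 - l) * (t_fps $ l / 5 ^ l)) +
    (\<Sum>l=0..<j. Y_fps $ l * (Z_fps $ (j - l + 1) / 2))"
proof -
  have "Y_fps * Z_fps = fps_X * (2 * alpha_fps - 1) + 36 * (n_fps * dil (1/5) t_fps)"
    unfolding Z_fps_def using Y_fps_identity by (simp only: mult.assoc)
  then have "(Y_fps * Z_fps) $ (j + 1) = (fps_X * (2 * alpha_fps - 1) + 36 * (n_fps * dil (1/5) t_fps)) $ (j + 1)"
    by (rule arg_cong)
  moreover have "(Y_fps * Z_fps) $ (j + 1) = (\<Sum>l=0..<j. Y_fps $ l * Z_fps $ (j - l + 1)) - 2 * Y_fps $ j"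
  proof -
    have "(Y_fps * Z_fps) $ (j + 1) = (\<Sum>l=0..Suc j. Y_fps $ l * Z_fps $ (Suc j - l))"
      by (simp add: fps_mult_nth)
    also have "\<dots> = (\<Sum>l=0..<j. Y_fps $ l * Z_fps $ (Suc j - l)) + Y_fps $ j * Z_fps $ 1 + Y_fps $ Suc j * Z_fps $ 0"
      by (simp add: atLeastLessThanSuc_atLeastAtMost [symmetric])
    also have "(\<Sum>l=0..<j. Y_fps $ l * Z_fps $ (Suc j - l)) = (\<Sum>l=0..<j. Y_fps $ l * Z_fps $ (j - l + 1))"
      by (intro sum.cong refl) (simp add: Suc_diff_le)
    finally show ?thesis
      unfolding Z_fps_0 Z_fps_1 by simp
  qed
  moreover have "(n_fps * dil (1/5) t_fps) $ (j + 1) = (\<Sum>l=0..j. n_fps $ (j + 1 - l) * (t_fps $ l / 5 ^ l))"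
  proof -
    have "(n_fps * dil (1/5) t_fps) $ (j + 1) = (dil (1/5) t_fps * n_fps) $ (j + 1)"
      by (simp only: mult.commute)
    also have "\<dots> = (\<Sum>l=0..Suc j. n_fps $ (j + 1 - l) * (t_fps $ l / 5 ^ l))"
      unfolding fps_mult_nth by (simp add: power_divide mult_ac)
    finally show ?thesis by (simp add: n_fps_0)
  qed
  moreover have "(fps_X * (2 * alpha_fps - 1) + 36 * (n_fps * dil (1/5) t_fps)) $ (j + 1) =
      2 * alpha_fps $ j + 36 * (n_fps * dil (1/5) t_fps) $ (j + 1)"
    using assms by (simp add: numeral_fps_const)
  ultimately show ?thesis
    by (simp add: sum_divide_distrib [symmetric])
qed

section \<open>Geometry of the gasket\<close>

lemma UNIV_three: "(UNIV :: 3 set) = {i, i + 1, i - 1}"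
  and three_distinct [simp]: "i + 1 \<noteq> i" "i - 1 \<noteq> i" "i \<noteq> i + 1" "i \<noteq> i - 1" "i + 1 \<noteq> i - 1" "i - 1 \<noteq> i + 1"
  for i :: 3
proof -
  have "i + 1 \<noteq> i" "i - 1 \<noteq> i" "i + 1 \<noteq> i - 1"
    using exhaust_3 [of i] by auto
  moreover have "card (UNIV :: 3 set) = 3" by simp
  ultimately have "card {i, i + 1, i - 1} = card (UNIV :: 3 set)"
    by auto
  then show "(UNIV :: 3 set) = {i, i + 1, i - 1}"
    by (metis card_subset_eq finite subset_UNIV)
  show "i + 1 \<noteq> i" "i - 1 \<noteq> i" "i \<noteq> i + 1" "i \<noteq> i - 1" "i + 1 \<noteq> i - 1" "i - 1 \<noteq> i + 1"
    using \<open>i + 1 \<noteq> i\<close> \<open>i - 1 \<noteq> i\<close> \<open>i + 1 \<noteq> i - 1\<close> by metis+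
qed

lemma sum_three: "(\<Sum>k\<in>UNIV. f k) = f i + (f (i + 1) + f (i - 1))" for i :: 3 and f :: "3 \<Rightarrow> 'a::comm_monoid_add"
  by (subst UNIV_three [of i]) simp

lemma three_cases: "k = i \<or> k = i + 1 \<or> k = i - 1" for i k :: 3
  using UNIV_three [of i] by blast

lemma three_arith [simp]: "(2 :: 3) \<noteq> 0" "(2 :: 3) \<noteq> 1" "(0 :: 3) \<noteq> 2" "(1 :: 3) \<noteq> 2" "(- 1 :: 3) = 2"
proof -
  show "(2 :: 3) \<noteq> 0" "(0 :: 3) \<noteq> 2"
    using three_distinct(5) [of 1] by simp_all
  show "(2 :: 3) \<noteq> 1" "(1 :: 3) \<noteq> 2"
    using three_distinct(1) [of 1] by simp_all
  show "(- 1 :: 3) = 2"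
    using three_cases [of 2 0] \<open>(2 :: 3) \<noteq> 0\<close> \<open>(2 :: 3) \<noteq> 1\<close> by simp
qed

section \<open>The contractions and the vertex sets\<close>

lemma contr_inj [simp]: "contr q i x = contr q i y \<longleftrightarrow> x = y"
  by (simp add: contr_def)

lemma contr_fix [simp]: "contr q i (q i) = q i"
  by (simp add: contr_def scaleR_2 [symmetric])

lemma contr_fix_iff [simp]: "contr q i x = q i \<longleftrightarrow> x = q i"
  by (metis contr_fix contr_inj)

lemma contr_commute: "contr q i (q j) = contr q j (q i)"
  by (simp add: contr_def add.commute)

lemma dist_contr: "dist (contr q i x) (contr q i y) = dist x y / 2"
  by (simp add: contr_def dist_norm scaleR_diff_right [symmetric])

lemma continuous_on_contr [continuous_intros]: "continuous_on S (contr q i)"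
  unfolding contr_def by (intro continuous_intros)

lemma contr_funpow_fix [simp]: "(contr q i ^^ m) (q i) = q i"
  by (induction m) auto

lemma dist_contr_funpow: "dist ((contr q i ^^ m) x) (q i) = dist x (q i) / 2 ^ m"
proof (induction m)
  case (Suc m)
  have "dist ((contr q i ^^ Suc m) x) (q i) = dist (contr q i ((contr q i ^^ m) x)) (contr q i (q i))"
    by simp
  then show ?case
    unfolding dist_contr by (simp add: Suc)
qed simp

lemma contr_funpow_tendsto: "(\<lambda>m. (contr q i ^^ m) x) \<longlonglongrightarrow> q i"
proof -
  have "(\<lambda>m. dist x (q i) * (1/2) ^ m) \<longlonglongrightarrow> dist x (q i) * 0"
    by (intro tendsto_intros) auto
  then have "(\<lambda>m. dist ((contr q i ^^ m) x) (q i)) \<longlonglongrightarrow> 0"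
    by (simp add: dist_contr_funpow power_one_over field_simps)
  then show ?thesis
    by (rule tendsto_dist_iff [THEN iffD2])
qed

lemma finite_vertices: "finite (vertices q m)"
  by (induction m) auto

lemma vertices_mono: "vertices q m \<subseteq> vertices q (Suc m)"
proof (induction m)
  case 0
  show ?case
  proof
    fix x assume "x \<in> vertices q 0"
    then obtain i where "x = q i" by auto
    then have "x \<in> contr q i ` vertices q 0"
      by (intro image_eqI [of _ _ "q i"]) simp_all
    then show "x \<in> vertices q (Suc 0)"
      unfolding vertices.simps(2) by (rule UN_I [OF UNIV_I])
  qed
next
  case (Suc m)
  then have "(\<Union>i. contr q i ` vertices q m) \<subseteq> (\<Union>i. contr q i ` vertices q (Suc m))"
    by (intro UN_mono image_mono subset_refl)
  then show ?case
    unfolding vertices.simps(2) .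
qed

lemma vertices_mono': "m \<le> n \<Longrightarrow> vertices q m \<subseteq> vertices q n"
  by (rule lift_Suc_mono_le [where f = "vertices q", OF vertices_mono])

lemma q_in_vertices [simp]: "q i \<in> vertices q m"
  using vertices_mono' [of 0 m q] by (simp add: image_subset_iff)

lemma contr_funpow_vertex: "(contr q i ^^ m) (q j) \<in> vertices q m"
  by (induction m) auto

section \<open>The gasket as the closure of its vertices\<close>

definition all_vertices :: "(3 \<Rightarrow> real^2) \<Rightarrow> (real^2) set" where
  "all_vertices q = (\<Union>m. vertices q m)"

lemma vertices_subset_all_vertices: "vertices q m \<subseteq> all_vertices q"
  by (auto simp: all_vertices_def)

lemma contr_all_vertices: "x \<in> all_vertices q \<Longrightarrow> contr q i x \<in> all_vertices q"
proof -
  assume "x \<in> all_vertices q"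
  then obtain m where "x \<in> vertices q m" by (auto simp: all_vertices_def)
  then have "contr q i x \<in> vertices q (Suc m)" by auto
  then show ?thesis using vertices_subset_all_vertices by (rule subsetD [rotated])
qed

lemma all_vertices_cases:
  assumes "x \<in> all_vertices q"
  obtains i y where "y \<in> all_vertices q" "x = contr q i y"
proof -
  obtain m where "x \<in> vertices q m"
    using assms by (auto simp: all_vertices_def)
  then have "x \<in> vertices q (Suc m)"
    using vertices_mono by (rule subsetD [rotated])
  then obtain i y where "y \<in> vertices q m" "x = contr q i y"
    by auto
  then show thesis
    by (intro that) (rule subsetD [OF vertices_subset_all_vertices])
qed

lemma gasket_closure_eq:
  assumes "compact (closure (all_vertices q))"
  shows "closure (all_vertices q) = (\<Union>i. contr q i ` closure (all_vertices q))"
proof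
  have "closed (\<Union>i. contr q i ` closure (all_vertices q))"
    by (intro closed_UN finite ballI compact_imp_closed compact_continuous_image assms continuous_intros)
  moreover have "all_vertices q \<subseteq> (\<Union>i. contr q i ` closure (all_vertices q))"
  proof
    fix x assume "x \<in> all_vertices q"
    then obtain i y where "y \<in> all_vertices q" "x = contr q i y"
      by (rule all_vertices_cases)
    then show "x \<in> (\<Union>i. contr q i ` closure (all_vertices q))"
      using subsetD [OF closure_subset] by auto
  qed
  ultimately show "closure (all_vertices q) \<subseteq> (\<Union>i. contr q i ` closure (all_vertices q))"
    by (rule closure_minimal [rotated])
  have "contr q i ` closure (all_vertices q) \<subseteq> closure (contr q i ` all_vertices q)" for i
    by (intro image_closure_subset continuous_intros closed_closure closure_subset)
  moreover have "closure (contr q i ` all_vertices q) \<subseteq> closure (all_vertices q)" for i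
    by (intro closure_mono image_subsetI contr_all_vertices)
  ultimately show "(\<Union>i. contr q i ` closure (all_vertices q)) \<subseteq> closure (all_vertices q)"
    by (intro UN_least) (rule order_trans)
qed

text \<open>A ball around the origin that contains the three corners is preserved by taking
  midpoints with them.\<close>

lemma bounded_all_vertices: "bounded (all_vertices q)"
proof -
  define C where "C = Max (range (\<lambda>i. norm (q i)))"
  have C: "norm (q i) \<le> C" for i
    unfolding C_def by (intro Max_ge) auto
  have "\<forall>x\<in>vertices q m. norm x \<le> C" for m
  proof (induction m)
    case 0
    then show ?case using C by auto
  next
    case (Suc m)
    have "norm (contr q i x) \<le> C" if "norm x \<le> C" for i x
    proof -
      have "norm (x + q i) \<le> C + C"
        using that C [of i] norm_triangle_ineq [of x "q i"] by linarith
      then show ?thesis by (simp add: contr_def)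
    qed
    then show ?case using Suc by auto
  qed
  then show ?thesis
    unfolding bounded_iff all_vertices_def by blast
qed

text \<open>Iterating one contraction puts its fixed point into \<open>K\<close>, and hence all
  vertices. Conversely, a point of \<open>K\<close> at maximal distance from the vertices is the
  image of a point of \<open>K\<close> at least twice as far away, so the maximal distance is
  0.\<close>

lemma invariant_compact_unique:
  assumes "K \<noteq> {}" "compact K" "K = (\<Union>i. contr q i ` K)"
  shows "K = closure (all_vertices q)"
proof
  have inv: "contr q i x \<in> K" if "x \<in> K" for i x
    by (subst assms(3)) (intro UN_I [of i] UNIV_I imageI that)
  have "q i \<in> K" for i
  proof -
    obtain x where x: "x \<in> K" using assms by blast
    have "(contr q i ^^ m) x \<in> K" for m
      by (induction m) (auto intro: inv x)
    then show ?thesis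
      using closed_sequentially [OF compact_imp_closed [OF assms(2)] _ contr_funpow_tendsto] by blast
  qed
  then have "vertices q m \<subseteq> K" for m
    by (induction m) (auto intro!: inv)
  then have "all_vertices q \<subseteq> K"
    by (auto simp: all_vertices_def)
  then show "closure (all_vertices q) \<subseteq> K"
    by (simp add: assms(2) closure_minimal compact_imp_closed)
  let ?A = "all_vertices q"
  have ne: "?A \<noteq> {}"
    unfolding all_vertices_def using q_in_vertices by blast
  have "continuous_on K (\<lambda>x. infdist x ?A)"
    by (intro continuous_intros)
  then obtain x where x: "x \<in> K" "\<And>y. y \<in> K \<Longrightarrow> infdist y ?A \<le> infdist x ?A"
    using continuous_attains_sup [OF assms(2,1)] by metis
  obtain i y where y: "y \<in> K" "x = contr q i y"
    using subst [OF assms(3), where P = "\<lambda>S. x \<in> S", OF x(1)] by blast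
  have "infdist x ?A \<le> dist y a / 2" if "a \<in> ?A" for a
  proof -
    have "contr q i a \<in> ?A"
      using that by (rule contr_all_vertices)
    then show ?thesis
      unfolding y(2) dist_contr [of q i y a, symmetric] by (rule infdist_le)
  qed
  then have "2 * infdist x ?A \<le> dist y a" if "a \<in> ?A" for a
    using that by fastforce
  then have "2 * infdist x ?A \<le> infdist y ?A"
    unfolding infdist_notempty [OF ne, of y] by (intro cINF_greatest ne)
  then have "infdist x ?A \<le> 0"
    using x(2) [OF y(1)] by linarith
  then have "infdist z ?A = 0" if "z \<in> K" for z
    using x(2) [OF that] infdist_nonneg [of z ?A] by linarith
  then show "K \<subseteq> closure ?A"
    by (simp add: subset_iff in_closure_iff_infdist_zero [OF ne])
qed

lemma gasket_eq_closure: "gasket q = closure (all_vertices q)"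
proof -
  have c: "compact (closure (all_vertices q))"
    using bounded_all_vertices compact_closure by blast
  have ne: "closure (all_vertices q) \<noteq> {}"
    unfolding all_vertices_def closure_eq_empty using q_in_vertices [of q 0 0] by blast
  show ?thesis
    unfolding gasket_def
    by (rule the_equality, intro conjI ne c gasket_closure_eq [OF c], elim conjE)
      (rule invariant_compact_unique)
qed

lemma compact_gasket: "compact (gasket q)"
  unfolding gasket_eq_closure using bounded_all_vertices compact_closure by blast

lemma gasket_invariant: "gasket q = (\<Union>i. contr q i ` gasket q)"
  using gasket_closure_eq [OF compact_gasket [of q, unfolded gasket_eq_closure]]
  unfolding gasket_eq_closure .

lemma contr_in_gasket [simp]: "x \<in> gasket q \<Longrightarrow> contr q i x \<in> gasket q"
  by (subst gasket_invariant) (intro UN_I [of i] UNIV_I imageI)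

lemma gasket_cases:
  assumes "x \<in> gasket q"
  obtains i y where "y \<in> gasket q" "x = contr q i y"
proof -
  have "x \<in> (\<Union>i. contr q i ` gasket q)"
    by (rule subst [OF gasket_invariant [of q], where P = "\<lambda>K. x \<in> K"]) (rule assms)
  then show thesis
    using that by blast
qed

lemma vertices_subset_gasket: "vertices q m \<subseteq> gasket q"
  unfolding gasket_eq_closure
  by (rule order_trans [OF vertices_subset_all_vertices closure_subset])

lemma q_in_gasket [simp]: "q i \<in> gasket q"
  using vertices_subset_gasket [of q 0] by auto

lemma contr_funpow_in_gasket [simp]: "x \<in> gasket q \<Longrightarrow> (contr q i ^^ m) x \<in> gasket q"
  by (induction m) auto

lemma word_contr_in_gasket [simp]: "x \<in> gasket q \<Longrightarrow> word_contr q w x \<in> gasket q"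
  by (induction w) auto

section \<open>Barycentric coordinates and the intersection of cells\<close>

locale equilateral_triangle =
  fixes q :: "3 \<Rightarrow> real^2"
  assumes equilateral: "equilateral q"
begin

definition side :: real where
  "side = (SOME r. r > 0 \<and> (\<forall>i j. i \<noteq> j \<longrightarrow> dist (q i) (q j) = r))"

lemma side: "side > 0" "i \<noteq> j \<Longrightarrow> dist (q i) (q j) = side"
proof -
  have "side > 0 \<and> (\<forall>i j. i \<noteq> j \<longrightarrow> dist (q i) (q j) = side)"
    unfolding side_def by (rule someI_ex) (use equilateral in \<open>simp only: equilateral_def\<close>)
  then show "side > 0" "i \<noteq> j \<Longrightarrow> dist (q i) (q j) = side" by blast+
qed

lemma q_inj [simp]: "q i = q j \<longleftrightarrow> i = j"
  using side(1) side(2) [of i j] by force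

definition centre :: "real^2" where
  "centre = (1/3) *\<^sub>R (\<Sum>k\<in>UNIV. q k)"

text \<open>Barycentric coordinates through inner products: (q k - centre) has squared norm side^2/3
  and inner product -side^2/6 with the other two such vectors, so the factor 2/side^2 and the
  summand 1/3 give the values 1 and 0 at the corners.\<close>

definition bary :: "3 \<Rightarrow> real^2 \<Rightarrow> real" where
  "bary k x = 1/3 + 2 / side\<^sup>2 * ((x - centre) \<bullet> (q k - centre))"

lemma inner_q: "i \<noteq> j \<Longrightarrow> q i \<bullet> q j = (q i \<bullet> q i + q j \<bullet> q j - side\<^sup>2) / 2"
proof -
  assume "i \<noteq> j"
  then have "norm (q i - q j) = side"
    using side(2) by (simp only: dist_norm)
  then have "side\<^sup>2 = (q i - q j) \<bullet> (q i - q j)"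
    by (metis power2_norm_eq_inner)
  also have "\<dots> = q i \<bullet> q i - 2 * (q i \<bullet> q j) + q j \<bullet> q j"
    by (simp add: inner_diff_left inner_diff_right inner_commute [of "q j" "q i"])
  finally have *: "side\<^sup>2 = q i \<bullet> q i - 2 * (q i \<bullet> q j) + q j \<bullet> q j" .
  have "b = (a + c - s) / 2" if "s = a - 2 * b + c" for a b c s :: real
    using that by (simp add: field_simps)
  from this [OF *] show ?thesis .
qed

lemma bary_q: "bary k (q l) = of_bool (k = l)"
proof -
  define a b c where "a = q k" and "b = q (k + 1)" and "c = q (k - 1)"
  have ab: "a \<bullet> b = (a \<bullet> a + b \<bullet> b - side\<^sup>2) / 2" and ac: "a \<bullet> c = (a \<bullet> a + c \<bullet> c - side\<^sup>2) / 2"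
    and bc: "b \<bullet> c = (b \<bullet> b + c \<bullet> c - side\<^sup>2) / 2"
    unfolding a_def b_def c_def by (intro inner_q three_distinct)+
  have centre: "centre = (1/3) *\<^sub>R (a + (b + c))"
    unfolding centre_def sum_three [of _ k] a_def b_def c_def ..
  have A: "a - centre = (1/3) *\<^sub>R (2 *\<^sub>R a - b - c)" and B: "b - centre = (1/3) *\<^sub>R (2 *\<^sub>R b - a - c)"
    and C: "c - centre = (1/3) *\<^sub>R (2 *\<^sub>R c - a - b)"
    unfolding centre by (simp_all add: vec_eq_iff field_simps)
  note expand = inner_scaleR_left inner_scaleR_right inner_diff_left inner_diff_right
    inner_commute [of b a] inner_commute [of c a] inner_commute [of c b] ab ac bc
  have "(a - centre) \<bullet> (a - centre) = side\<^sup>2 / 3"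
    unfolding A expand by argo
  moreover have "(b - centre) \<bullet> (a - centre) = - side\<^sup>2 / 6" "(c - centre) \<bullet> (a - centre) = - side\<^sup>2 / 6"
    unfolding A B C expand by argo+
  ultimately have "bary k a = 1" "bary k b = 0" "bary k c = 0"
    using side(1) unfolding bary_def a_def [symmetric] by (simp_all only:) simp_all
  then show ?thesis
    using three_cases [of l k] unfolding a_def b_def c_def by (elim disjE) simp_all
qed

lemma bary_contr: "bary k (contr q i x) = (bary k x + of_bool (k = i)) / 2"
proof -
  have c: "contr q i x - centre = (1/2) *\<^sub>R ((x - centre) + (q i - centre))"
    unfolding contr_def by (simp add: vec_eq_iff field_simps)
  have "2 * (1/3 + s * ((1/2) * (a + b))) = (1/3 + s * a) + (1/3 + s * b)" for a b s :: real
    by (simp add: algebra_simps)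
  then have "2 * bary k (contr q i x) = bary k x + bary k (q i)"
    unfolding bary_def c inner_scaleR_left inner_add_left by blast
  then show ?thesis by (simp add: bary_q)
qed

lemma continuous_on_bary [continuous_intros]: "continuous_on S (bary k)"
  unfolding bary_def by (intro continuous_intros)

lemma sum_bary: "(\<Sum>k\<in>UNIV. bary k x) = 1"
proof -
  have "(\<Sum>k\<in>UNIV. q k - centre) = 0"
    by (simp add: sum_subtractf centre_def)
  then show ?thesis
    by (simp only: bary_def sum.distrib sum_distrib_left [symmetric] inner_sum_right [symmetric]) simp
qed

text \<open>Induction over the vertices, extended to their closure.\<close>

lemma gasket_closed_induct:
  assumes "closed S" "\<And>i. q i \<in> S" "\<And>i x. x \<in> S \<Longrightarrow> contr q i x \<in> S" "x \<in> gasket q"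
  shows "x \<in> S"
proof -
  have "vertices q m \<subseteq> S" for m
    by (induction m) (auto intro: assms)
  then have "all_vertices q \<subseteq> S"
    by (auto simp: all_vertices_def)
  then show ?thesis
    using closure_minimal [OF _ assms(1), THEN subsetD] assms(4) unfolding gasket_eq_closure by simp
qed

lemma bary_nonneg: "x \<in> gasket q \<Longrightarrow> bary k x \<ge> 0"
proof -
  have "closed {x. \<forall>k. bary k x \<ge> 0}"
    by (intro closed_Collect_all closed_Collect_le continuous_intros)
  then show "x \<in> gasket q \<Longrightarrow> bary k x \<ge> 0"
    using gasket_closed_induct [of "{x. \<forall>k. bary k x \<ge> 0}" x]
    by (auto simp: bary_q bary_contr)
qed

lemma sum_bary_q: "x \<in> gasket q \<Longrightarrow> (\<Sum>k\<in>UNIV. bary k x *\<^sub>R q k) = x"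
proof -
  have "closed {x. (\<Sum>k\<in>UNIV. bary k x *\<^sub>R q k) = x}"
    by (intro closed_Collect_eq continuous_intros)
  moreover have "(\<Sum>k\<in>UNIV. bary k (q i) *\<^sub>R q k) = q i" for i
    unfolding sum_three [of _ i] by (simp add: bary_q)
  moreover have "(\<Sum>k\<in>UNIV. bary k (contr q i x) *\<^sub>R q k) = contr q i x"
    if "(\<Sum>k\<in>UNIV. bary k x *\<^sub>R q k) = x" for i x
  proof -
    have "(\<Sum>k\<in>UNIV. bary k (contr q i x) *\<^sub>R q k) = (1/2) *\<^sub>R ((\<Sum>k\<in>UNIV. bary k x *\<^sub>R q k) + q i)"
      unfolding sum_three [of _ i] by (simp add: bary_contr algebra_simps add_divide_distrib)
    then show ?thesis using that by (simp add: contr_def)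
  qed
  ultimately show "x \<in> gasket q \<Longrightarrow> ?thesis"
    using gasket_closed_induct [of "{x. (\<Sum>k\<in>UNIV. bary k x *\<^sub>R q k) = x}" x] by simp
qed

lemma bary_eq_1:
  assumes "x \<in> gasket q" "bary j x \<ge> 1"
  shows "x = q j"
proof -
  have "bary j x + (bary (j + 1) x + bary (j - 1) x) = 1"
    using sum_bary [of x] by (simp add: sum_three [of _ j])
  then have "bary j x = 1" "bary (j + 1) x = 0" "bary (j - 1) x = 0"
    using assms bary_nonneg [OF assms(1), of "j + 1"] bary_nonneg [OF assms(1), of "j - 1"] by linarith+
  then show ?thesis
    using sum_bary_q [OF assms(1)] by (simp add: sum_three [of _ j])
qed

text \<open>On the gasket the j-th coordinate is at least 1/2 in cell j and at most 1/2 in any other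
  cell. Equality in both coordinates i and j leaves only the junction point.\<close>

lemma contr_eq_contr:
  assumes "x \<in> gasket q" "y \<in> gasket q" "contr q i x = contr q j y" "i \<noteq> j"
  shows "x = q j" "y = q i"
proof -
  have "bary j (contr q i x) = bary j (contr q j y)" "bary i (contr q i x) = bary i (contr q j y)"
    using assms(3) by simp_all
  then have "bary j x \<ge> 1" "bary i y \<ge> 1"
    using assms(4) bary_nonneg [OF assms(2), of j] bary_nonneg [OF assms(1), of i]
    by (auto simp: bary_contr)
  then show "x = q j" "y = q i"
    using assms(1,2) by (auto intro: bary_eq_1)
qed

lemma contr_eq_q:
  assumes "x \<in> gasket q" "contr q i x = q j"
  shows "i = j" "x = q j"
proof -
  have "contr q i x = contr q j (q j)"
    using assms by simp
  then have "i = j"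
    using contr_eq_contr [OF assms(1), of "q j" i j] by auto
  then show "i = j" "x = q j"
    using assms(2) by auto
qed

lemma vertices_contr:
  assumes "contr q i x \<in> vertices q (Suc m)" "x \<in> gasket q"
  shows "x \<in> vertices q m"
proof -
  obtain j y where y: "y \<in> vertices q m" "contr q i x = contr q j y"
    using assms(1) by auto
  then show ?thesis
    using contr_eq_contr [OF assms(2), of y i j] vertices_subset_gasket [of q m]
    by (cases "i = j") auto
qed

section \<open>Neighbour sums on the graph approximations\<close>

lemma adjacent_in_gasket:
  assumes "adjacent q m x y"
  shows "x \<in> gasket q" "y \<in> gasket q"
  using assms vertices_subset_gasket unfolding adjacent_def by blast+

lemma adjacent_0: "adjacent q 0 x y \<longleftrightarrow> x \<in> range q \<and> y \<in> range q \<and> x \<noteq> y"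
  by (auto simp: adjacent_def)

text \<open>Removing the first letter of the word turns adjacency into a recursion on the level, on
  which all neighbour sums below rest.\<close>

lemma adjacent_Suc:
  "adjacent q (Suc m) x y \<longleftrightarrow>
     (\<exists>i x' y'. x = contr q i x' \<and> y = contr q i y' \<and> adjacent q m x' y')"
proof
  assume "adjacent q (Suc m) x y"
  then obtain w where xy: "x \<in> vertices q (Suc m)" "y \<in> vertices q (Suc m)" "x \<noteq> y"
    and w: "length w = Suc m" "x \<in> word_contr q w ` gasket q" "y \<in> word_contr q w ` gasket q"
    unfolding adjacent_def by auto
  obtain i v where v: "w = i # v" "length v = m"
    using w(1) by (cases w) auto
  obtain x' y' where x': "x = contr q i x'" "x' \<in> word_contr q v ` gasket q"
    and y': "y = contr q i y'" "y' \<in> word_contr q v ` gasket q"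
    using w v by auto
  then have "x' \<in> vertices q m" "y' \<in> vertices q m"
    using xy vertices_contr word_contr_in_gasket by (metis (mono_tags, lifting) imageE)+
  then have "adjacent q m x' y'"
    unfolding adjacent_def using xy x' y' v by auto
  then show "\<exists>i x' y'. x = contr q i x' \<and> y = contr q i y' \<and> adjacent q m x' y'"
    using x' y' by blast
next
  assume "\<exists>i x' y'. x = contr q i x' \<and> y = contr q i y' \<and> adjacent q m x' y'"
  then obtain i x' y' w where *: "x = contr q i x'" "y = contr q i y'" "x' \<in> vertices q m" "y' \<in> vertices q m"
    "x' \<noteq> y'" "length w = m" "x' \<in> word_contr q w ` gasket q" "y' \<in> word_contr q w ` gasket q"
    unfolding adjacent_def by blast
  then have "x \<in> word_contr q (i # w) ` gasket q" "y \<in> word_contr q (i # w) ` gasket q"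
    by auto
  moreover have "x \<in> vertices q (Suc m)" "y \<in> vertices q (Suc m)" "x \<noteq> y" "length (i # w) = Suc m"
    using * by auto
  ultimately show "adjacent q (Suc m) x y"
    unfolding adjacent_def by blast
qed

lemma finite_adjacent [simp]: "finite {y. adjacent q m x y}"
  by (rule finite_subset [OF _ finite_vertices [of q m]]) (auto simp: adjacent_def)

text \<open>A corner \<open>q j\<close> lies in cell \<open>i\<close> only for \<open>i = j\<close>,
  so at every level it has neighbours in one cell only.\<close>

lemma adjacent_q: "{y. adjacent q m (q j) y} = {(contr q j ^^ m) (q (j + 1)), (contr q j ^^ m) (q (j - 1))}"
proof (induction m)
  case 0
  have "range q = {q j, q (j + 1), q (j - 1)}"
    by (simp only: UNIV_three [of j] image_insert image_empty)
  moreover have "{y. adjacent q 0 (q j) y} = range q - {q j}"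
    unfolding adjacent_0 by auto
  ultimately show ?case
    by (simp add: insert_Diff_if)
next
  case (Suc m)
  have "adjacent q (Suc m) (q j) y \<longleftrightarrow> (\<exists>y'. y = contr q j y' \<and> adjacent q m (q j) y')" for y
  proof
    assume "adjacent q (Suc m) (q j) y"
    then obtain i x' y' where *: "q j = contr q i x'" "y = contr q i y'" "adjacent q m x' y'"
      unfolding adjacent_Suc by blast
    then have "i = j" "x' = q j"
      using contr_eq_q [OF adjacent_in_gasket(1) [OF *(3)] *(1) [symmetric]] by simp_all
    then show "\<exists>y'. y = contr q j y' \<and> adjacent q m (q j) y'"
      using *(2,3) by (intro exI [of _ y']) simp
  next
    assume "\<exists>y'. y = contr q j y' \<and> adjacent q m (q j) y'"
    then obtain y' where "y = contr q j y'" "adjacent q m (q j) y'"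
      by (elim exE conjE)
    then show "adjacent q (Suc m) (q j) y"
      unfolding adjacent_Suc by (intro exI [of _ j] exI [of _ "q j"] exI [of _ y']) simp
  qed
  then have "{y. adjacent q (Suc m) (q j) y} = contr q j ` {y. adjacent q m (q j) y}"
    by (intro set_eqI) (simp add: image_iff Bex_def conj_commute)
  then show ?case
    unfolding Suc by simp
qed

lemma contr_funpow_inj [simp]: "(contr q j ^^ m) x = (contr q j ^^ m) y \<longleftrightarrow> x = y"
  by (induction m) auto

lemma sum_adjacent_q:
  fixes h :: "real^2 \<Rightarrow> 'a::comm_monoid_add"
  shows
  "(\<Sum>y | adjacent q m (q j) y. h y) = h ((contr q j ^^ m) (q (j + 1))) + h ((contr q j ^^ m) (q (j - 1)))"
  unfolding adjacent_q by simp

text \<open>The image of a point that is not a corner lies in just one cell of level 1, and all its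
  neighbours lie there too.\<close>

lemma sum_adjacent_inner:
  fixes h :: "real^2 \<Rightarrow> 'a::comm_monoid_add"
  assumes "x \<in> gasket q" "x \<notin> range q"
  shows "(\<Sum>y | adjacent q (Suc m) (contr q i x) y. h y) = (\<Sum>y | adjacent q m x y. h (contr q i y))"
proof -
  have "adjacent q (Suc m) (contr q i x) y \<longleftrightarrow> (\<exists>y'. y = contr q i y' \<and> adjacent q m x y')" for y
  proof
    assume "adjacent q (Suc m) (contr q i x) y"
    then obtain k x' y' where *: "contr q i x = contr q k x'" "y = contr q k y'" "adjacent q m x' y'"
      unfolding adjacent_Suc by blast
    have "k = i"
    proof (rule ccontr)
      assume "k \<noteq> i"
      then have "x = q k"
        using contr_eq_contr(1) [OF assms(1) adjacent_in_gasket(1) [OF *(3)] *(1)] by simp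
      then show False using assms(2) by simp
    qed
    then show "\<exists>y'. y = contr q i y' \<and> adjacent q m x y'"
      using * by auto
  qed (auto simp: adjacent_Suc)
  then have "{y. adjacent q (Suc m) (contr q i x) y} = contr q i ` {y. adjacent q m x y}"
    by (intro set_eqI) (simp add: image_iff Bex_def conj_commute)
  then show ?thesis
    by (simp add: sum.reindex inj_on_def)
qed

lemma sum_adjacent_junction:
  fixes h :: "real^2 \<Rightarrow> 'a::comm_monoid_add"
  assumes "i \<noteq> j"
  shows "(\<Sum>y | adjacent q (Suc m) (contr q i (q j)) y. h y) =
    (\<Sum>y | adjacent q m (q j) y. h (contr q i y)) + (\<Sum>y | adjacent q m (q i) y. h (contr q j y))"
proof -
  have "adjacent q (Suc m) (contr q i (q j)) y \<longleftrightarrow>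
    (\<exists>y'. y = contr q i y' \<and> adjacent q m (q j) y') \<or> (\<exists>y'. y = contr q j y' \<and> adjacent q m (q i) y')" for y
  proof
    assume "adjacent q (Suc m) (contr q i (q j)) y"
    then obtain k x' y' where *: "contr q i (q j) = contr q k x'" "y = contr q k y'" "adjacent q m x' y'"
      unfolding adjacent_Suc by blast
    show "(\<exists>y'. y = contr q i y' \<and> adjacent q m (q j) y') \<or> (\<exists>y'. y = contr q j y' \<and> adjacent q m (q i) y')"
    proof (cases "k = i")
      case True
      then show ?thesis using * by auto
    next
      case False
      then have "q j = q k" "x' = q i"
        using contr_eq_contr [OF q_in_gasket adjacent_in_gasket(1) [OF *(3)] *(1)] by simp_all
      then show ?thesis using * by auto
    qed
  next
    assume "(\<exists>y'. y = contr q i y' \<and> adjacent q m (q j) y') \<or> (\<exists>y'. y = contr q j y' \<and> adjacent q m (q i) y')"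
    then show "adjacent q (Suc m) (contr q i (q j)) y"
      unfolding adjacent_Suc by (metis contr_commute)
  qed
  then have eq: "{y. adjacent q (Suc m) (contr q i (q j)) y} =
      contr q i ` {y. adjacent q m (q j) y} \<union> contr q j ` {y. adjacent q m (q i) y}"
    by (intro set_eqI) (simp add: image_iff Bex_def conj_commute)
  \<comment> \<open>A common neighbour would be the junction point itself, but no vertex is adjacent
    to itself.\<close>
  have "contr q i y \<noteq> contr q j z" if "adjacent q m (q j) y" "adjacent q m (q i) z" for y z
    using contr_eq_contr(1) [of y z i j] adjacent_in_gasket(2) [OF that(1)] adjacent_in_gasket(2) [OF that(2)]
      that(1) assms unfolding adjacent_def by metis
  then show ?thesis
    unfolding eq
    by (subst sum.union_disjoint) (simp_all add: sum.reindex inj_on_def, fastforce)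
qed

text \<open>The Laplacian is tested only at non-corner vertices. These are dense because each corner
  is a limit of images of another corner under its own contraction.\<close>

lemma gasket_subset_closure_interior_vertices:
  "gasket q \<subseteq> closure (\<Union>m. vertices q m - vertices q 0)"
proof -
  let ?A = "\<Union>m. vertices q m - vertices q 0"
  have "q i \<in> closure ?A" for i
  proof -
    have "(contr q i ^^ Suc m) (q (i + 1)) \<in> ?A" for m
    proof -
      have "(contr q i ^^ Suc m) (q (i + 1)) \<noteq> q j" for j :: 3
        using contr_eq_q [of "(contr q i ^^ m) (q (i + 1))" i j] contr_funpow_inj [where j = i and m = m and x = "q (i+1)" and y = "q i"]
        by (auto simp del: contr_funpow_inj)
      then have "(contr q i ^^ Suc m) (q (i + 1)) \<in> vertices q (Suc m) - vertices q 0"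
        unfolding vertices.simps(1) by (intro DiffI contr_funpow_vertex) auto
      then show ?thesis by (rule UN_I [OF UNIV_I])
    qed
    then show ?thesis
      using LIMSEQ_Suc [OF contr_funpow_tendsto [of q i "q (i + 1)"]] unfolding closure_sequential
      by (intro exI [of _ "\<lambda>m. (contr q i ^^ Suc m) (q (i + 1))"] conjI allI)
  qed
  moreover have "?A \<subseteq> closure ?A" by (rule closure_subset)
  ultimately have "all_vertices q \<subseteq> closure ?A"
    unfolding all_vertices_def by auto
  then show ?thesis
    unfolding gasket_eq_closure by (simp add: closure_minimal)
qed

section \<open>Formal eigenfunctions\<close>

definition refine :: "(3 \<Rightarrow> 3 \<Rightarrow> 3 \<Rightarrow> real) \<Rightarrow> (3 \<Rightarrow> 3 \<Rightarrow> real^2 \<Rightarrow> real) \<Rightarrow>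
    (3 \<Rightarrow> real^2 \<Rightarrow> real) \<Rightarrow> 3 \<Rightarrow> 3 \<Rightarrow> real^2 \<Rightarrow> real" where
  "refine c g f i k x = (\<Sum>l\<in>UNIV. c i k l * f l x) + g i k x"

definition paste :: "(3 \<Rightarrow> 3 \<Rightarrow> 3 \<Rightarrow> real) \<Rightarrow> (3 \<Rightarrow> 3 \<Rightarrow> real^2 \<Rightarrow> real) \<Rightarrow>
    (3 \<Rightarrow> real^2 \<Rightarrow> real) \<Rightarrow> 3 \<Rightarrow> real^2 \<Rightarrow> real" where
  "paste c g f k x = (let i = SOME i. x \<in> contr q i ` gasket q in refine c g f i k (2 *\<^sub>R x - q i))"

lemma uncontr: "2 *\<^sub>R contr q i x - q i = x"
  by (simp add: contr_def)

lemma contr_uncontr: "contr q i (2 *\<^sub>R x - q i) = x"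
  by (simp add: contr_def)

text \<open>The hypothesis \<open>match\<close> makes the choice of cell in \<open>paste\<close>
  immaterial at junction points, the only points where it is ambiguous.\<close>

lemma paste_contr:
  assumes v: "\<And>k l. f k (q l) = v k l"
    and match: "\<And>i j k. (\<Sum>l\<in>UNIV. c i k l * v l j) + g i k (q j) = (\<Sum>l\<in>UNIV. c j k l * v l i) + g j k (q i)"
    and x: "x \<in> gasket q"
  shows "paste c g f k (contr q i x) = refine c g f i k x"
proof -
  define j where "j = (SOME j. contr q i x \<in> contr q j ` gasket q)"
  have "contr q i x \<in> contr q j ` gasket q"
    unfolding j_def by (rule someI [of _ i]) (use x in blast)
  then obtain y where y: "y \<in> gasket q" "contr q i x = contr q j y"
    by blast
  have "paste c g f k (contr q i x) = refine c g f j k (2 *\<^sub>R contr q i x - q j)"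
    unfolding paste_def Let_def j_def [symmetric] ..
  also have "\<dots> = refine c g f j k y"
    unfolding y(2) uncontr ..
  also have "\<dots> = refine c g f i k x"
  proof (cases "i = j")
    case False
    then show ?thesis
      using contr_eq_contr [OF x y(1,2)] match [of i k j] by (simp add: refine_def v)
  qed (use y in simp)
  finally show ?thesis .
qed

lemma continuous_on_pieces:
  assumes "\<And>i. continuous_on (gasket q) (\<lambda>x. f (contr q i x))"
  shows "continuous_on (gasket q) f"
proof -
  have "continuous_on (contr q i ` gasket q) f" for i
  proof -
    have "continuous_on (contr q i ` gasket q) (\<lambda>z. f (contr q i (2 *\<^sub>R z - q i)))"
      by (rule continuous_on_compose2 [OF assms [of i], where f = "\<lambda>z. 2 *\<^sub>R z - q i"])
        (auto intro!: continuous_intros simp: uncontr)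
    then show ?thesis
      by (simp only: contr_uncontr)
  qed
  moreover have "closed (contr q i ` gasket q)" for i
    by (intro compact_imp_closed compact_continuous_image compact_gasket continuous_intros)
  ultimately have "continuous_on (\<Union>i\<in>UNIV. contr q i ` gasket q) f"
    by (intro continuous_on_closed_Union) auto
  then show ?thesis
    unfolding gasket_invariant [symmetric] .
qed

text \<open>The prescribed identities form a fixed point equation for the operator
  \<open>paste c g\<close>, a contraction in the maximum norm because the absolute row sums are at
  most \<open>r\<close>. The conditions \<open>corner\<close> and \<open>match\<close> ensure that
  it preserves the corner values and that its output is continuous.\<close>

lemma self_similar_functions_exist:
  fixes c :: "3 \<Rightarrow> 3 \<Rightarrow> 3 \<Rightarrow> real" and g :: "3 \<Rightarrow> 3 \<Rightarrow> real^2 \<Rightarrow> real" and v :: "3 \<Rightarrow> 3 \<Rightarrow> real"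
  assumes r: "0 \<le> r" "r < 1" "\<And>i k. (\<Sum>l\<in>UNIV. \<bar>c i k l\<bar>) \<le> r"
    and g: "\<And>i k. continuous_on (gasket q) (g i k)"
    and corner: "\<And>i k. v k i = (\<Sum>l\<in>UNIV. c i k l * v l i) + g i k (q i)"
    and match: "\<And>i j k. (\<Sum>l\<in>UNIV. c i k l * v l j) + g i k (q j) = (\<Sum>l\<in>UNIV. c j k l * v l i) + g j k (q i)"
  shows "\<exists>f. (\<forall>k. continuous_on (gasket q) (f k)) \<and> (\<forall>k l. f k (q l) = v k l) \<and>
    (\<forall>i k x. x \<in> gasket q \<longrightarrow> f k (contr q i x) = (\<Sum>l\<in>UNIV. c i k l * f l x) + g i k x)"
proof -
  \<comment> \<open>The iteration starts from affine interpolation of the corner values.\<close>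
  define f0 :: "3 \<Rightarrow> real^2 \<Rightarrow> real" where "f0 = (\<lambda>k x. \<Sum>l\<in>UNIV. v k l * bary l x)"
  define F where "F = (\<lambda>n. (paste c g ^^ n) f0)"
  have F_Suc: "F (Suc n) = paste c g (F n)" for n
    by (simp add: F_def)
  have F_v: "F n k (q l) = v k l" for n k l
  proof (induction n arbitrary: k l)
    case 0
    show ?case
      by (simp add: F_def f0_def bary_q of_bool_def if_distrib cong: if_cong)
  next
    case (Suc n)
    have "F (Suc n) k (q l) = paste c g (F n) k (contr q l (q l))"
      by (simp add: F_Suc)
    also have "\<dots> = refine c g (F n) l k (q l)"
      by (rule paste_contr [where v = v, OF Suc match q_in_gasket])
    also have "\<dots> = v k l"
      unfolding refine_def Suc by (rule corner [symmetric])
    finally show ?case .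
  qed
  have F_contr: "F (Suc n) k (contr q i x) = (\<Sum>l\<in>UNIV. c i k l * F n l x) + g i k x"
    if "x \<in> gasket q" for n k i x
    unfolding F_Suc refine_def [symmetric]
    by (rule paste_contr [where v = v, OF F_v match that])
  have F_cont: "continuous_on (gasket q) (F n k)" for n k
  proof (induction n arbitrary: k)
    case 0
    show ?case
      unfolding F_def f0_def by (simp, intro continuous_intros)
  next
    case (Suc n)
    show ?case
    proof (rule continuous_on_pieces)
      fix i
      have "continuous_on (gasket q) (\<lambda>x. (\<Sum>l\<in>UNIV. c i k l * F n l x) + g i k x)"
        by (intro continuous_intros Suc g)
      then show "continuous_on (gasket q) (\<lambda>x. F (Suc n) k (contr q i x))"
        by (rule continuous_on_eq) (simp add: F_contr)
    qed
  qed
  have "\<exists>C. \<forall>x\<in>gasket q. \<bar>F 1 k x - F 0 k x\<bar> \<le> C" for k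
  proof -
    have "bounded ((\<lambda>x. F 1 k x - F 0 k x) ` gasket q)"
      by (intro compact_imp_bounded compact_continuous_image compact_gasket continuous_intros F_cont)
    then show ?thesis
      by (auto simp: bounded_iff)
  qed
  then obtain C where C: "\<And>k x. x \<in> gasket q \<Longrightarrow> \<bar>F 1 k x - F 0 k x\<bar> \<le> C k"
    by metis
  define D where "D = Max (range C)"
  have "C k \<le> D" for k
    unfolding D_def by (intro Max_ge) auto
  then have D: "\<bar>F 1 k x - F 0 k x\<bar> \<le> D" if "x \<in> gasket q" for k x
    using C [OF that] order_trans by blast
  have D0: "D \<ge> 0"
    using D [of "q 0" 0] by (metis abs_ge_zero order_trans q_in_gasket)
  have diff: "\<bar>F (Suc n) k x - F n k x\<bar> \<le> D * r ^ n" if "x \<in> gasket q" for n k x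
    using that
  proof (induction n arbitrary: k x)
    case 0
    then show ?case using D by simp
  next
    case (Suc n)
    obtain i y where y: "y \<in> gasket q" "x = contr q i y"
      using Suc.prems by (rule gasket_cases)
    have "F (Suc (Suc n)) k x - F (Suc n) k x = (\<Sum>l\<in>UNIV. c i k l * (F (Suc n) l y - F n l y))"
      unfolding y(2) F_contr [OF y(1)] by (simp add: sum_subtractf right_diff_distrib)
    also have "\<bar>\<dots>\<bar> \<le> (\<Sum>l\<in>UNIV. \<bar>c i k l\<bar> * (D * r ^ n))"
      by (rule order_trans [OF sum_abs]) (intro sum_mono, simp add: abs_mult mult_left_mono Suc.IH [OF y(1)])
    also have "\<dots> \<le> r * (D * r ^ n)"
      unfolding sum_distrib_right [symmetric] by (intro mult_right_mono r) (simp add: r D0)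
    finally show ?case by (simp add: mult_ac)
  qed
  \<comment> \<open>The limit is written as a telescoping series, dominated by the geometric series
    of \<open>D * r ^ n\<close>.\<close>
  define S where "S = (\<lambda>k x. \<Sum>n. F (Suc n) k x - F n k x)"
  have "uniform_limit (gasket q) (\<lambda>n x. \<Sum>i<n. F (Suc i) k x - F i k x) (S k) sequentially" for k
    unfolding S_def
    by (rule Weierstrass_m_test [where M = "\<lambda>n. D * r ^ n"]) (auto intro!: summable_mult summable_geometric simp: diff r)
  moreover have "(\<Sum>i<n. F (Suc i) k x - F i k x) = F n k x - F 0 k x" for n k x
    by (rule sum_lessThan_telescope [of "\<lambda>i. F i k x"])
  ultimately have lim: "uniform_limit (gasket q) (\<lambda>n x. F n k x - F 0 k x) (S k) sequentially" for k
    by (simp only:)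
  define f where "f = (\<lambda>k x. F 0 k x + S k x)"
  have "continuous_on (gasket q) (S k)" for k
    by (rule uniform_limit_theorem [OF _ lim]) (auto intro!: always_eventually continuous_intros F_cont)
  then have f1: "continuous_on (gasket q) (f k)" for k
    unfolding f_def by (intro continuous_intros F_cont)
  have lim': "(\<lambda>n. F n k x) \<longlonglongrightarrow> f k x" if "x \<in> gasket q" for k x
  proof -
    have "(\<lambda>n. F 0 k x + (F n k x - F 0 k x)) \<longlonglongrightarrow> F 0 k x + S k x"
      by (intro tendsto_intros tendsto_uniform_limitI [OF lim] that)
    then show ?thesis by (simp add: f_def)
  qed
  have f2: "f k (q l) = v k l" for k l
    using lim' [OF q_in_gasket, of k l] by (simp add: F_v LIMSEQ_const_iff)
  have f3: "f k (contr q i x) = (\<Sum>l\<in>UNIV. c i k l * f l x) + g i k x" if "x \<in> gasket q" for i k x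
  proof -
    have "(\<lambda>n. F (Suc n) k (contr q i x)) \<longlonglongrightarrow> (\<Sum>l\<in>UNIV. c i k l * f l x) + g i k x"
      unfolding F_contr [OF that] by (intro tendsto_intros lim' that)
    moreover have "(\<lambda>n. F (Suc n) k (contr q i x)) \<longlonglongrightarrow> f k (contr q i x)"
      by (intro LIMSEQ_Suc lim' contr_in_gasket that)
    ultimately show ?thesis
      by (rule LIMSEQ_unique [rotated])
  qed
  show ?thesis
    using f1 f2 f3 by (intro exI [of _ f] conjI allI impI)
qed

text \<open>The weight of the corner value \<open>B k\<close> in the value at the point
  \<open>contr q i (q l)\<close> for a formal eigenfunction. Its constant term is the harmonic
  extension rule with weights 2/5, 2/5, 1/5.\<close>

definition ext_coeff :: "3 \<Rightarrow> 3 \<Rightarrow> 3 \<Rightarrow> real fps" where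
  "ext_coeff i k l = (if l = i then of_bool (k = i)
     else ext_p * (of_bool (k = i) + of_bool (k = l)) + ext_p * ext_q)"

lemma ext_coeff_diag: "ext_coeff i k i = of_bool (k = i)"
  by (simp add: ext_coeff_def)

lemma ext_coeff_sym: "ext_coeff i k j = ext_coeff j k i"
  by (simp add: ext_coeff_def add.commute)

lemma ext_coeff_0: "ext_coeff i k l $ 0 = (if l = i then of_bool (k = i)
    else if k = i \<or> k = l then 2/5 else 1/5)"
  by (simp add: ext_coeff_def)

text \<open>
  The harmonic extension matrices fix the constants and so do not contract.  The coefficients
  \<open>c\<close> below agree with them on families with sum 1, do contract, and force the sum to be 1.
\<close>

lemma harmonic_basis_exists:
  "\<exists>f. (\<forall>k. continuous_on (gasket q) (f k)) \<and> (\<forall>k l. f k (q l) = of_bool (k = l)) \<and>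
    (\<forall>i k x. x \<in> gasket q \<longrightarrow> f k (contr q i x) = (\<Sum>l\<in>UNIV. ext_coeff i k l $ 0 * f l x))"
proof -
  \<comment> \<open>Only the rows with k = i differ from the harmonic ones: 2/5 is subtracted from
    each entry and restored as the constant \<open>g\<close>, which is neutral when the functions
    sum to 1. All absolute row sums become 3/5.\<close>
  define c :: "3 \<Rightarrow> 3 \<Rightarrow> 3 \<Rightarrow> real" where
    "c = (\<lambda>i k l. if k = i then (if l = i then 3/5 else 0) else if l = i then 0 else if l = k then 2/5 else 1/5)"
  define g :: "3 \<Rightarrow> 3 \<Rightarrow> real^2 \<Rightarrow> real" where "g = (\<lambda>i k x. if k = i then 2/5 else 0)"
  have h1: "(\<Sum>l\<in>UNIV. \<bar>c i k l\<bar>) \<le> 3/5" for i k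
    using three_cases [of k i] unfolding sum_three [of _ i] by (elim disjE) (simp_all add: c_def)
  have h2: "continuous_on (gasket q) (g i k)" for i k
    by (simp add: g_def)
  have h3: "of_bool (k = i) = (\<Sum>l\<in>UNIV. c i k l * of_bool (l = i)) + g i k (q i)" for i k
    unfolding sum_three [of _ i] by (simp add: c_def g_def)
  have h4: "(\<Sum>l\<in>UNIV. c i k l * of_bool (l = j)) + g i k (q j) = (\<Sum>l\<in>UNIV. c j k l * of_bool (l = i)) + g j k (q i)"
    for i j k
    unfolding sum_three [of _ i] using three_cases [of j i] three_cases [of k i]
    by (elim disjE) (simp_all add: c_def g_def)
  have "\<exists>f. (\<forall>k. continuous_on (gasket q) (f k)) \<and> (\<forall>k l. f k (q l) = of_bool (k = l)) \<and>
      (\<forall>i k x. x \<in> gasket q \<longrightarrow> f k (contr q i x) = (\<Sum>l\<in>UNIV. c i k l * f l x) + g i k x)"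
    by (rule self_similar_functions_exist [where r = "3/5" and v = "\<lambda>k l. of_bool (k = l)" and c = c and g = g,
          OF _ _ h1 h2 h3 h4]) simp_all
  then obtain f where f: "\<And>k. continuous_on (gasket q) (f k)" "\<And>k l. f k (q l) = of_bool (k = l)"
    "\<And>i k x. x \<in> gasket q \<Longrightarrow> f k (contr q i x) = (\<Sum>l\<in>UNIV. c i k l * f l x) + g i k x"
    by (elim exE conjE) blast
  \<comment> \<open>The column sums of \<open>c\<close> are 3/5 too, so the deviation of the sum
    from 1 shrinks by 3/5 from a point to its image; at a maximum point this forces it to be
    0.\<close>
  define s where "s = (\<lambda>x. \<bar>(\<Sum>k\<in>UNIV. f k x) - 1\<bar>)"
  have s_contr: "s (contr q i x) = 3/5 * s x" if "x \<in> gasket q" for i x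
  proof -
    have "(\<Sum>k\<in>UNIV. f k (contr q i x)) - 1 = 3/5 * ((\<Sum>k\<in>UNIV. f k x) - 1)"
      unfolding f(3) [OF that] sum_three [of _ i] by (simp add: c_def g_def algebra_simps)
    then show ?thesis
      unfolding s_def by (simp only: abs_mult)
  qed
  have "continuous_on (gasket q) s"
    unfolding s_def by (intro continuous_intros f)
  then obtain x where x: "x \<in> gasket q" "\<And>y. y \<in> gasket q \<Longrightarrow> s y \<le> s x"
    using continuous_attains_sup [OF compact_gasket, of q s] q_in_gasket by (metis empty_iff)
  obtain i y where y: "y \<in> gasket q" "x = contr q i y"
    using x(1) by (rule gasket_cases)
  have "s x \<le> 0"
  proof -
    have "s y \<le> s x" "s x = 3/5 * s y" "0 \<le> s y"
      using x(2) [OF y(1)] s_contr [OF y(1), of i] y(2) by (simp_all add: s_def)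
    then show ?thesis by argo
  qed
  have s1: "(\<Sum>k\<in>UNIV. f k z) = 1" if "z \<in> gasket q" for z
    using x(2) [OF that] \<open>s x \<le> 0\<close> unfolding s_def by linarith
  have "f k (contr q i x) = (\<Sum>l\<in>UNIV. ext_coeff i k l $ 0 * f l x)" if "x \<in> gasket q" for i k x
  proof -
    have "f i x + (f (i + 1) x + f (i - 1) x) = 1"
      using s1 [OF that] unfolding sum_three [of _ i] .
    then show ?thesis
      unfolding f(3) [OF that] using three_cases [of k i] unfolding sum_three [of _ i]
      by (elim disjE) (simp_all add: c_def g_def ext_coeff_0)
  qed
  then show ?thesis
    using f(1,2) by (intro exI [of _ f] conjI allI impI)
qed

text \<open>The series are built coefficient by coefficient. For n > 0 the n-th functional equation
  is affine with matrix \<open>ext_coeff i k l $ 0 * (1/5) ^ n\<close>, which contracts, and with an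
  inhomogeneity formed from earlier coefficients; n = 0 is the harmonic case.\<close>

lemma eigenfunction_basis_exists:
  "\<exists>\<psi>. (\<forall>k n. continuous_on (gasket q) (\<lambda>x. \<psi> k x $ n)) \<and> (\<forall>k l. \<psi> k (q l) = of_bool (k = l)) \<and>
    (\<forall>i k x. x \<in> gasket q \<longrightarrow> \<psi> k (contr q i x) = (\<Sum>l\<in>UNIV. ext_coeff i k l * dil (1/5) (\<psi> l x)))"
proof -
  define R :: "(nat \<Rightarrow> 3 \<Rightarrow> real^2 \<Rightarrow> real) \<Rightarrow> nat \<Rightarrow> (3 \<Rightarrow> real^2 \<Rightarrow> real) \<Rightarrow> bool" where
    "R = (\<lambda>f n r. (\<forall>k. continuous_on (gasket q) (r k)) \<and> (\<forall>k l. r k (q l) = of_bool (n = 0 \<and> k = l)) \<and>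
      (\<forall>i k. \<forall>x\<in>gasket q. r k (contr q i x) = (\<Sum>l\<in>UNIV. (ext_coeff i k l $ 0 * (1/5) ^ n) * r l x) +
        (\<Sum>l\<in>UNIV. \<Sum>m<n. ext_coeff i k l $ (n - m) * ((1/5) ^ m * f m l x))))"
  have "\<exists>f. \<forall>n. R f n (f n)"
  proof (rule dependent_wellorder_choice)
    fix r :: "3 \<Rightarrow> real^2 \<Rightarrow> real" and f g :: "nat \<Rightarrow> 3 \<Rightarrow> real^2 \<Rightarrow> real" and n
    assume "\<And>m. m < n \<Longrightarrow> f m = g m"
    then have "(\<Sum>l\<in>UNIV. \<Sum>m<n. ext_coeff i k l $ (n - m) * ((1/5) ^ m * f m l x)) =
        (\<Sum>l\<in>UNIV. \<Sum>m<n. ext_coeff i k l $ (n - m) * ((1/5) ^ m * g m l x))" for i k x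
      by (intro sum.cong) auto
    then show "R f n r = R g n r"
      unfolding R_def by simp
  next
    fix n and f :: "nat \<Rightarrow> 3 \<Rightarrow> real^2 \<Rightarrow> real"
    assume IH: "\<And>m. m < n \<Longrightarrow> R f m (f m)"
    show "\<exists>r. R f n r"
    proof (cases "n = 0")
      case True
      obtain r where "\<And>k. continuous_on (gasket q) (r k)" "\<And>k l. r k (q l) = of_bool (k = l)"
        "\<And>i k x. x \<in> gasket q \<Longrightarrow> r k (contr q i x) = (\<Sum>l\<in>UNIV. ext_coeff i k l $ 0 * r l x)"
        using harmonic_basis_exists by (elim exE conjE) blast
      then have "R f n r"
        using True unfolding R_def by simp
      then show ?thesis by (intro exI [of _ r])
    next
      case False
      have fc: "continuous_on (gasket q) (f m k)" and fq: "f m k (q l) = of_bool (m = 0 \<and> k = l)" if "m < n" for m k l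
        using IH [OF that] unfolding R_def by blast+
      define g where "g = (\<lambda>i k x. \<Sum>l\<in>UNIV. \<Sum>m<n. ext_coeff i k l $ (n - m) * ((1/5) ^ m * f m l x))"
      \<comment> \<open>At a corner only the coefficient m = 0 is nonzero, so one term survives. The
        corner and matching conditions then reduce to \<open>ext_coeff_diag\<close> and
        \<open>ext_coeff_sym\<close>.\<close>
      have gq: "g i k (q j) = ext_coeff i k j $ n" for i j k
      proof -
        have "(\<Sum>m<n. ext_coeff i k l $ (n - m) * ((1/5) ^ m * f m l (q j))) = (if l = j then ext_coeff i k l $ n else 0)" for l
        proof -
          have "(\<Sum>m<n. ext_coeff i k l $ (n - m) * ((1/5) ^ m * f m l (q j))) =
              (\<Sum>m<n. if m = 0 then (if l = j then ext_coeff i k l $ n else 0) else 0)"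
            by (intro sum.cong refl) (simp add: fq)
          then show ?thesis
            using False by simp
        qed
        then show ?thesis
          unfolding g_def by simp
      qed
      \<comment> \<open>The largest absolute row sum of the harmonic matrix is 1 + 2/5 + 2/5 = 9/5,
        and (1/5)^n is at most 1/5.\<close>
      have h1: "(\<Sum>l\<in>UNIV. \<bar>ext_coeff i k l $ 0 * (1/5) ^ n\<bar>) \<le> 9/25" for i k
      proof -
        have "((1/5) ^ n :: real) \<le> (1/5) ^ 1"
          using False by (intro power_decreasing) auto
        moreover have "(\<Sum>l\<in>UNIV. \<bar>ext_coeff i k l $ 0\<bar>) \<le> 9/5"
          using three_cases [of k i] unfolding sum_three [of _ i] by (elim disjE) (simp_all add: ext_coeff_0)
        ultimately have "(\<Sum>l\<in>UNIV. \<bar>ext_coeff i k l $ 0\<bar>) * (1/5) ^ n \<le> 9/5 * (1/5)"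
          by (intro mult_mono) (auto simp: sum_nonneg)
        then show ?thesis
          by (simp add: abs_mult sum_distrib_right)
      qed
      have h2: "continuous_on (gasket q) (g i k)" for i k
        unfolding g_def by (intro continuous_intros fc) auto
      have h3: "0 = (\<Sum>l\<in>UNIV. ext_coeff i k l $ 0 * (1/5) ^ n * 0) + g i k (q i)" for i k
        using False by (simp add: gq ext_coeff_diag of_bool_def)
      have h4: "(\<Sum>l\<in>UNIV. ext_coeff i k l $ 0 * (1/5) ^ n * 0) + g i k (q j) =
          (\<Sum>l\<in>UNIV. ext_coeff j k l $ 0 * (1/5) ^ n * 0) + g j k (q i)" for i j k
        by (simp add: gq ext_coeff_sym [of i k j])
      have "\<exists>r. (\<forall>k. continuous_on (gasket q) (r k)) \<and> (\<forall>k l. r k (q l) = 0) \<and>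
        (\<forall>i k x. x \<in> gasket q \<longrightarrow>
          r k (contr q i x) = (\<Sum>l\<in>UNIV. (ext_coeff i k l $ 0 * (1/5) ^ n) * r l x) + g i k x)"
        by (rule self_similar_functions_exist [where r = "9/25" and v = "\<lambda>k l. 0" and g = g
              and c = "\<lambda>i k l. ext_coeff i k l $ 0 * (1/5) ^ n", OF _ _ h1 h2 h3 h4]) simp_all
      then obtain r where "\<And>k. continuous_on (gasket q) (r k)" "\<And>k l. r k (q l) = 0"
        "\<And>i k x. x \<in> gasket q \<Longrightarrow> r k (contr q i x) = (\<Sum>l\<in>UNIV. (ext_coeff i k l $ 0 * (1/5) ^ n) * r l x) + g i k x"
        by (elim exE conjE) blast
      then have "R f n r"
        using False unfolding R_def g_def by simp
      then show ?thesis by (intro exI [of _ r])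
    qed
  qed
  then obtain f where f: "\<And>n. R f n (f n)" by blast
  define \<psi> where "\<psi> = (\<lambda>k x. Abs_fps (\<lambda>n. f n k x))"
  show ?thesis
  proof (intro exI [of _ \<psi>] conjI allI impI)
    show "continuous_on (gasket q) (\<lambda>x. \<psi> k x $ n)" for k n
      using f [of n] unfolding \<psi>_def R_def by simp
    show "\<psi> k (q l) = of_bool (k = l)" for k l
      using f unfolding \<psi>_def R_def by (intro fps_ext) (simp add: of_bool_def)
    show "\<psi> k (contr q i x) = (\<Sum>l\<in>UNIV. ext_coeff i k l * dil (1/5) (\<psi> l x))" if "x \<in> gasket q" for i k x
    proof (rule fps_ext)
      fix n
      have "(ext_coeff i k l * dil (1/5) (\<psi> l x)) $ n = (ext_coeff i k l $ 0 * (1/5) ^ n) * f n l x +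
          (\<Sum>m<n. ext_coeff i k l $ (n - m) * ((1/5) ^ m * f m l x))" for l
      proof -
        have "(ext_coeff i k l * dil (1/5) (\<psi> l x)) $ n = (dil (1/5) (\<psi> l x) * ext_coeff i k l) $ n"
          by (simp only: mult.commute)
        also have "\<dots> = (\<Sum>m<Suc n. ext_coeff i k l $ (n - m) * ((1/5) ^ m * f m l x))"
          unfolding fps_mult_nth lessThan_Suc_atMost atMost_atLeast0
          by (intro sum.cong) (simp_all add: \<psi>_def mult_ac)
        finally show ?thesis by simp
      qed
      then show "\<psi> k (contr q i x) $ n = (\<Sum>l\<in>UNIV. ext_coeff i k l * dil (1/5) (\<psi> l x)) $ n"
        using f [of n] that unfolding R_def by (simp add: \<psi>_def fps_sum_nth sum.distrib)
    qed
  qed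
qed

section \<open>The formal eigenfunction with given corner values\<close>

definition basis :: "3 \<Rightarrow> real^2 \<Rightarrow> real fps" where
  "basis = (SOME \<psi>. (\<forall>k n. continuous_on (gasket q) (\<lambda>x. \<psi> k x $ n)) \<and> (\<forall>k l. \<psi> k (q l) = of_bool (k = l)) \<and>
    (\<forall>i k x. x \<in> gasket q \<longrightarrow> \<psi> k (contr q i x) = (\<Sum>l\<in>UNIV. ext_coeff i k l * dil (1/5) (\<psi> l x))))"

lemma basis_props: "(\<forall>k n. continuous_on (gasket q) (\<lambda>x. basis k x $ n)) \<and> (\<forall>k l. basis k (q l) = of_bool (k = l)) \<and>
    (\<forall>i k x. x \<in> gasket q \<longrightarrow> basis k (contr q i x) = (\<Sum>l\<in>UNIV. ext_coeff i k l * dil (1/5) (basis l x)))"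
  unfolding basis_def by (rule someI_ex [OF eigenfunction_basis_exists])

text \<open>The corner values are themselves power series in \<lambda>, so every chain of functions
  linked by the Laplacian is given by one \<open>B\<close>.\<close>

definition Phi :: "(3 \<Rightarrow> real fps) \<Rightarrow> real^2 \<Rightarrow> real fps" where
  "Phi B x = (\<Sum>k\<in>UNIV. B k * basis k x)"

text \<open>
  The solution of the three equations \<open>4 * alpha_fps' * u x = (\<Sum>y. u y)\<close> at the junction points, where
  \<open>y\<close> runs through the four neighbours of \<open>x\<close> at level 1.
\<close>

definition ext :: "(3 \<Rightarrow> real fps) \<Rightarrow> 3 \<Rightarrow> 3 \<Rightarrow> real fps" where
  "ext B i l = (if l = i then B i else ext_p * (B i + B l) + ext_p * ext_q * (\<Sum>k\<in>UNIV. B k))"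

lemma continuous_on_Phi: "continuous_on (gasket q) (\<lambda>x. Phi B x $ n)"
  unfolding Phi_def fps_sum_nth fps_mult_nth
  using basis_props by (intro continuous_intros) blast

lemma basis_q: "basis k (q l) = (if k = l then 1 else 0)"
  using basis_props by (simp add: of_bool_def)

lemma Phi_q [simp]: "Phi B (q l) = B l"
  by (simp add: Phi_def basis_q if_distrib cong: if_cong)

text \<open>Restricted to a cell, a formal eigenfunction has eigenvalue \<lambda>/5. The
  substitution \<open>dil (1/5)\<close> also acts on the corner data, so the new corner values
  \<open>ext B i l\<close> are first dilated by 5.\<close>

lemma Phi_contr:
  assumes "x \<in> gasket q"
  shows "Phi B (contr q i x) = dil (1/5) (Phi (\<lambda>l. dil 5 (ext B i l)) x)"
proof -
  have e: "(\<Sum>k\<in>UNIV. B k * ext_coeff i k l) = ext B i l" for l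
  proof (cases "l = i")
    case True
    then show ?thesis
      unfolding sum_three [of _ i] by (simp add: ext_coeff_def ext_def)
  next
    case False
    then have "l = i + 1 \<or> l = i - 1"
      using three_cases [of l i] by simp
    then show ?thesis
      unfolding ext_def sum_three [of _ i] by (auto simp: ext_coeff_def algebra_simps)
  qed
  have "Phi B (contr q i x) = (\<Sum>k\<in>UNIV. \<Sum>l\<in>UNIV. B k * (ext_coeff i k l * dil (1/5) (basis l x)))"
    unfolding Phi_def using basis_props assms by (simp add: sum_distrib_left)
  also have "\<dots> = (\<Sum>l\<in>UNIV. \<Sum>k\<in>UNIV. (B k * ext_coeff i k l) * dil (1/5) (basis l x))"
    by (subst sum.swap) (simp only: mult.assoc)
  also have "\<dots> = (\<Sum>l\<in>UNIV. ext B i l * dil (1/5) (basis l x))"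
    unfolding sum_distrib_right [symmetric] e ..
  finally show ?thesis
    by (simp add: Phi_def dil_dil)
qed

section \<open>Boundary derivatives and the Laplacian of formal eigenfunctions\<close>

definition cell_data :: "(3 \<Rightarrow> real fps) \<Rightarrow> 3 \<Rightarrow> 3 \<Rightarrow> real fps" where
  "cell_data B i l = dil 5 (ext B i l)"

lemma dil_cell_data [simp]: "dil (1/5) (cell_data B i l) = ext B i l"
  by (simp add: cell_data_def dil_dil)

lemma ext_self [simp]: "ext B i i = B i"
  by (simp add: ext_def)

lemma ext_commute: "ext B i j = ext B j i"
  by (simp add: ext_def add.commute)

lemma Phi_cell_data: "x \<in> gasket q \<Longrightarrow> Phi B (contr q i x) = dil (1/5) (Phi (cell_data B i) x)"
  using Phi_contr [of x B i] unfolding cell_data_def .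

text \<open>
  Both defects are multiplied by a series in each subdivision of the corner cell; \<open>normal_defect\<close> vanishes
  on the eigenfunction of the monomials \<open>P\<^sub>j\<^sub>1\<close>, whose values next to the corner are \<open>dil ((1/5)^m) alpha_fps\<close>.
\<close>

definition normal_defect :: "nat \<Rightarrow> (3 \<Rightarrow> real fps) \<Rightarrow> 3 \<Rightarrow> real fps" where
  "normal_defect m B j = 2 * dil ((1/5) ^ m) alpha_fps * B j
     - (Phi B ((contr q j ^^ m) (q (j + 1))) + Phi B ((contr q j ^^ m) (q (j - 1))))"

definition tangential_defect :: "nat \<Rightarrow> (3 \<Rightarrow> real fps) \<Rightarrow> 3 \<Rightarrow> real fps" where
  "tangential_defect m B j = Phi B ((contr q j ^^ m) (q (j + 1))) - Phi B ((contr q j ^^ m) (q (j - 1)))"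

lemma normal_defect_0: "normal_defect 0 B j = 2 * alpha_fps * B j - (B (j + 1) + B (j - 1))"
  and tangential_defect_0: "tangential_defect 0 B j = B (j + 1) - B (j - 1)"
  by (simp_all add: normal_defect_def tangential_defect_def)

lemma normal_defect_Suc: "normal_defect (Suc m) B j = dil (1/5) (normal_defect m (cell_data B j) j)"
  and tangential_defect_Suc: "tangential_defect (Suc m) B j = dil (1/5) (tangential_defect m (cell_data B j) j)"
  by (simp_all add: normal_defect_def tangential_defect_def Phi_cell_data dil_dil)

lemma dil_normal_defect_0: "dil (1/5) (normal_defect 0 (cell_data B i) j) = 2 * alpha_fps' * ext B i j - (ext B i (j + 1) + ext B i (j - 1))"
  and dil_tangential_defect_0: "dil (1/5) (tangential_defect 0 (cell_data B i) j) = ext B i (j + 1) - ext B i (j - 1)"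
  by (simp_all add: normal_defect_0 tangential_defect_0)

lemma ext_next: "ext B j (j + 1) = ext_p * (B j + B (j + 1)) + ext_p * ext_q * (B j + (B (j + 1) + B (j - 1)))"
  and ext_prev: "ext B j (j - 1) = ext_p * (B j + B (j - 1)) + ext_p * ext_q * (B j + (B (j + 1) + B (j - 1)))"
  by (simp_all add: ext_def sum_three [of B j])

text \<open>One subdivision multiplies the defect by
  \<open>(2 * alpha_fps' + 1) * ext_p * ext_q\<close>; the functional equation of
  \<open>normal_fps\<close> absorbs this factor up to the constant 3/5.\<close>

lemma normal_defect_step: "5 * dil (1/5) normal_fps * dil (1/5) (normal_defect 0 (cell_data B j) j) = 3 * normal_fps * normal_defect 0 B j"
  unfolding dil_normal_defect_0 normal_defect_0 [of B j] ext_next ext_prev ext_self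
  using ext_p ext_q normal_fps_rec alpha_fps_rec by algebra

text \<open>The symmetric part of \<open>ext\<close> cancels in the difference, which leaves the
  multiplier \<open>ext_p\<close>, absorbed by \<open>tangential_fps\<close> up to the constant
  1/5.\<close>

lemma tangential_defect_step: "5 * dil (1/5) tangential_fps * dil (1/5) (tangential_defect 0 (cell_data B j) j) = tangential_fps * tangential_defect 0 B j"
  unfolding dil_tangential_defect_0 tangential_defect_0 [of B j] ext_next ext_prev
  using tangential_fps_rec by algebra

lemma fps_const_power_Suc: "fps_const (numeral k ^ Suc m :: real) = numeral k * fps_const (numeral k ^ m)"
  by (simp add: numeral_fps_const)

lemma normal_defect_eq:
  "fps_const (5 ^ m) * (normal_defect m B j * dil ((1/5) ^ m) normal_fps) = fps_const (3 ^ m) * (normal_fps * normal_defect 0 B j)"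
proof (induction m arbitrary: B)
  case (Suc m)
  have "dil (1/5) (fps_const (5 ^ m) * (normal_defect m (cell_data B j) j * dil ((1/5) ^ m) normal_fps)) =
      dil (1/5) (fps_const (3 ^ m) * (normal_fps * normal_defect 0 (cell_data B j) j))"
    by (simp only: Suc)
  then have "fps_const (5 ^ m) * (normal_defect (Suc m) B j * dil ((1/5) ^ Suc m) normal_fps) =
      fps_const (3 ^ m) * (dil (1/5) normal_fps * dil (1/5) (normal_defect 0 (cell_data B j) j))"
    by (simp add: normal_defect_Suc dil_dil)
  then show ?case
    unfolding fps_const_power_Suc using normal_defect_step [of B j] by algebra
qed simp

lemma tangential_defect_eq:
  "fps_const (5 ^ m) * (tangential_defect m B j * dil ((1/5) ^ m) tangential_fps) = tangential_fps * tangential_defect 0 B j"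
proof (induction m arbitrary: B)
  case (Suc m)
  have "dil (1/5) (fps_const (5 ^ m) * (tangential_defect m (cell_data B j) j * dil ((1/5) ^ m) tangential_fps)) =
      dil (1/5) (tangential_fps * tangential_defect 0 (cell_data B j) j)"
    by (simp only: Suc)
  then have "fps_const (5 ^ m) * (tangential_defect (Suc m) B j * dil ((1/5) ^ Suc m) tangential_fps) =
      dil (1/5) tangential_fps * dil (1/5) (tangential_defect 0 (cell_data B j) j)"
    by (simp add: tangential_defect_Suc dil_dil)
  then show ?case
    unfolding fps_const_power_Suc using tangential_defect_step [of B j] by algebra
qed simp

lemma dil_inverse_cancel:
  assumes "F $ 0 \<noteq> 0"
  shows "dil c F * dil c (inverse F) = 1"
proof -
  have "F * inverse F = 1"
    using assms by (subst mult.commute, intro inverse_mult_eq_1)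
  then show ?thesis
    by (simp only: dil_mult [symmetric] dil_1)
qed

text \<open>The telescoped defect gives the limit, since \<open>dil ((1/5) ^ m) normal_fps\<close>
  tends to 1. The defect contains \<open>2 * dil ((1/5) ^ m) alpha_fps * B j\<close> instead of
  \<open>2 * B j\<close>; this discrepancy is of order 5^(-m), and after scaling by (5/3)^m it still
  decays like 3^(-m).\<close>

lemma has_normal_deriv_Phi:
  "has_normal_deriv q (\<lambda>x. Phi B x $ n) j ((normal_fps * (2 * alpha_fps * B j - (B (j + 1) + B (j - 1)))) $ n)"
proof -
  let ?c = "\<lambda>m. (1/5::real) ^ m"
  let ?D = "normal_fps * normal_defect 0 B j"
  have "fps_const (5 ^ m) * normal_defect m B j = fps_const (3 ^ m) * (?D * dil (?c m) (inverse normal_fps))" for m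
    using normal_defect_eq [of m B j] dil_inverse_cancel [of normal_fps "?c m"] by simp algebra
  then have "(fps_const (5 ^ m) * normal_defect m B j) $ n = (fps_const (3 ^ m) * (?D * dil (?c m) (inverse normal_fps))) $ n" for m
    by simp
  moreover have "(5/3) ^ m * a = b" if "5 ^ m * a = 3 ^ m * b" for a b :: real and m
    using that by (simp add: power_divide field_simps)
  ultimately have *: "(5/3) ^ m * normal_defect m B j $ n = (?D * dil (?c m) (inverse normal_fps)) $ n" for m
    by (simp only: fps_mult_left_const_nth)
  have **: "2 * Phi B (q j) $ n - Phi B ((contr q j ^^ m) (q (j + 1))) $ n - Phi B ((contr q j ^^ m) (q (j - 1))) $ n
      = normal_defect m B j $ n - ?c m * (2 * B j * fps_X * dil (?c m) alpha_quot) $ n" for m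
  proof -
    have "2 * Phi B (q j) - Phi B ((contr q j ^^ m) (q (j + 1))) - Phi B ((contr q j ^^ m) (q (j - 1)))
        = normal_defect m B j - fps_const (?c m) * (2 * B j * fps_X * dil (?c m) alpha_quot)"
      unfolding normal_defect_def Phi_q using dil_alpha_fps_minus_1 [of m] by algebra
    then have "(2 * Phi B (q j) - Phi B ((contr q j ^^ m) (q (j + 1))) - Phi B ((contr q j ^^ m) (q (j - 1)))) $ n
        = (normal_defect m B j - fps_const (?c m) * (2 * B j * fps_X * dil (?c m) alpha_quot)) $ n"
      by (rule arg_cong)
    then show ?thesis
      by (simp add: numeral_fps_const mult.assoc)
  qed
  have "(5/3) ^ m * (?c m * z) = (1/3) ^ m * z" for m and z :: real
    by (simp add: power_divide)
  then have "(5/3) ^ m * (2 * Phi B (q j) $ n - Phi B ((contr q j ^^ m) (q (j + 1))) $ n - Phi B ((contr q j ^^ m) (q (j - 1))) $ n)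
      = (?D * dil (?c m) (inverse normal_fps)) $ n - (1/3) ^ m * (2 * B j * fps_X * dil (?c m) alpha_quot) $ n" for m
    unfolding ** right_diff_distrib * by simp
  moreover have "(\<lambda>m. (?D * dil (?c m) (inverse normal_fps)) $ n - (1/3) ^ m * (2 * B j * fps_X * dil (?c m) alpha_quot) $ n)
      \<longlonglongrightarrow> ?D $ n * inverse normal_fps $ 0 - 0 * ((2 * B j * fps_X) $ n * alpha_quot $ 0)"
    by (intro tendsto_intros tendsto_mult_dil_nth LIMSEQ_power_zero) simp
  ultimately show ?thesis
    unfolding has_normal_deriv_def by (simp add: normal_defect_0)
qed

lemma has_tangential_deriv_Phi:
  "has_tangential_deriv q (\<lambda>x. Phi B x $ n) j ((tangential_fps * (B (j + 1) - B (j - 1))) $ n)"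
proof -
  let ?c = "\<lambda>m. (1/5::real) ^ m"
  let ?D = "tangential_fps * tangential_defect 0 B j"
  have "fps_const (5 ^ m) * tangential_defect m B j = ?D * dil (?c m) (inverse tangential_fps)" for m
    using tangential_defect_eq [of m B j] dil_inverse_cancel [of tangential_fps "?c m"] by simp algebra
  then have "(fps_const (5 ^ m) * tangential_defect m B j) $ n = (?D * dil (?c m) (inverse tangential_fps)) $ n" for m
    by simp
  then have "5 ^ m * (Phi B ((contr q j ^^ m) (q (j + 1))) $ n - Phi B ((contr q j ^^ m) (q (j - 1))) $ n)
      = (?D * dil (?c m) (inverse tangential_fps)) $ n" for m
    by (simp add: tangential_defect_def)
  moreover have "(\<lambda>m. (?D * dil (?c m) (inverse tangential_fps)) $ n) \<longlonglongrightarrow> ?D $ n * inverse tangential_fps $ 0"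
    by (rule tendsto_mult_dil_nth)
  ultimately show ?thesis
    unfolding has_tangential_deriv_def by (simp add: tangential_defect_0)
qed

section \<open>The Laplacian of a formal eigenfunction\<close>

lemma sum_ext: "(\<Sum>l\<in>UNIV. ext B i l) = B i + ext_p * (B i + (\<Sum>k\<in>UNIV. B k)) + 2 * ext_p * ext_q * (\<Sum>k\<in>UNIV. B k)"
  unfolding sum_three [of _ i] ext_next ext_prev ext_self by (simp add: algebra_simps)

text \<open>This is the level 1 equation at a junction point, four times \<open>alpha_fps'\<close>
  times the value against the sum of the four neighbours, which \<open>ext\<close> was chosen to
  solve.\<close>

lemma junction_defect:
  assumes "i \<noteq> j"
  shows "dil (1/5) (normal_defect 0 (cell_data B i) j) + dil (1/5) (normal_defect 0 (cell_data B j) i) = 0"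
proof -
  have "ext B i (j + 1) + ext B i (j - 1) = (\<Sum>l\<in>UNIV. ext B i l) - ext B i j"
    "ext B j (i + 1) + ext B j (i - 1) = (\<Sum>l\<in>UNIV. ext B j l) - ext B i j"
    unfolding sum_three [of "ext B i" j] sum_three [of "ext B j" i] ext_commute [of B j i] by simp_all
  moreover have "ext B i j = ext_p * (B i + B j) + ext_p * ext_q * (\<Sum>k\<in>UNIV. B k)"
    using assms by (simp add: ext_def)
  ultimately show ?thesis
    unfolding dil_normal_defect_0 ext_commute [of B j i]
    using sum_ext [of B i] sum_ext [of B j] ext_p ext_q by algebra
qed

text \<open>By induction on the level: a point inside a cell is rescaled to the previous level, and
  at a junction point of level 1 the two cells contribute normal defects that cancel.\<close>

lemma sum_adjacent_Phi:
  assumes "x \<in> vertices q m - vertices q 0"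
  shows "(\<Sum>y | adjacent q m x y. Phi B y - Phi B x) = 4 * (dil ((1/5) ^ m) alpha_fps - 1) * Phi B x"
  using assms
proof (induction m arbitrary: x B)
  case (Suc m)
  obtain i y where y: "y \<in> vertices q m" "x = contr q i y"
    using Suc.prems by auto
  then have yK: "y \<in> gasket q"
    using vertices_subset_gasket by blast
  show ?case
  proof (cases "y \<in> range q")
    case False
    have "(\<Sum>z | adjacent q (Suc m) x z. Phi B z - Phi B x) = (\<Sum>z | adjacent q m y z. Phi B (contr q i z) - Phi B (contr q i y))"
      unfolding y(2) by (rule sum_adjacent_inner [OF yK False])
    also have "\<dots> = (\<Sum>z | adjacent q m y z. dil (1/5) (Phi (cell_data B i) z - Phi (cell_data B i) y))"
      using adjacent_in_gasket(2) by (intro sum.cong refl) (simp add: Phi_cell_data yK)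
    also have "\<dots> = dil (1/5) (4 * (dil ((1/5) ^ m) alpha_fps - 1) * Phi (cell_data B i) y)"
      unfolding dil_sum [symmetric] by (subst Suc.IH) (use False y in auto)
    finally show ?thesis
      by (simp add: y(2) Phi_cell_data yK dil_dil)
  next
    case True
    then obtain j where j: "y = q j" by auto
    have "i \<noteq> j"
      using Suc.prems unfolding y(2) j by auto
    let ?h = "\<lambda>z. Phi B z - Phi B x"
    let ?c = "(1/5::real) ^ m"
    have x: "Phi B x = ext B i j"
      unfolding y(2) j by (simp add: Phi_cell_data)
    have p: "h ((contr q k ^^ m) (q (k + 1))) + h ((contr q k ^^ m) (q (k - 1))) =
        2 * dil ((1/5) ^ Suc m) alpha_fps * ext B i j - dil (1/5) (normal_defect m (cell_data B l) k) - 2 * ext B i j"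
      if "h = (\<lambda>z. Phi B (contr q l z) - Phi B x)" "ext B l k = ext B i j" for h k l
      unfolding that(1) x normal_defect_def by (simp add: Phi_cell_data dil_dil that(2) algebra_simps)
    have "(\<Sum>z | adjacent q (Suc m) x z. ?h z) =
        (\<Sum>z | adjacent q m (q j) z. ?h (contr q i z)) + (\<Sum>z | adjacent q m (q i) z. ?h (contr q j z))"
      unfolding y(2) j by (rule sum_adjacent_junction [OF \<open>i \<noteq> j\<close>])
    also have "\<dots> = 4 * (dil ((1/5) ^ Suc m) alpha_fps - 1) * ext B i j
        - (dil (1/5) (normal_defect m (cell_data B i) j) + dil (1/5) (normal_defect m (cell_data B j) i))"
      unfolding sum_adjacent_q p [OF refl refl] p [OF refl ext_commute] by (simp add: algebra_simps)
    also have "dil (1/5) (normal_defect m (cell_data B i) j) + dil (1/5) (normal_defect m (cell_data B j) i) = 0" (is "?D = 0")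
    proof -
      \<comment> \<open>In both cells the finer defect is the same multiple of the coarsest one, so
        the cancellation in \<open>junction_defect\<close> passes to every level.\<close>
      have e: "fps_const (5 ^ m) * (dil (1/5) (normal_defect m B' k) * dil ((1/5) ^ Suc m) normal_fps)
          = fps_const (3 ^ m) * (dil (1/5) normal_fps * dil (1/5) (normal_defect 0 B' k))" for B' k
        using arg_cong [OF normal_defect_eq [of m B' k], of "dil (1/5)"] by (simp add: dil_dil)
      have "fps_const (5 ^ m) * (?D * dil ((1/5) ^ Suc m) normal_fps) = 0"
        using e [of "cell_data B i" j] e [of "cell_data B j" i] junction_defect [OF \<open>i \<noteq> j\<close>, of B] by algebra
      moreover have "fps_const (5 ^ m :: real) \<noteq> 0"
        by simp
      moreover have "dil ((1/5) ^ Suc m) normal_fps \<noteq> 0"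
        by (rule fps_nonzeroI [of _ 0]) simp
      ultimately show ?thesis
        by (simp only: mult_eq_0_iff) simp
    qed
    finally show ?thesis
      unfolding x by simp
  qed
qed simp

lemma graph_laplacian_Phi:
  assumes "x \<in> vertices q m - vertices q 0"
  shows "graph_laplacian q m (\<lambda>x. Phi B x $ n) x =
    (if n = 0 then 0 else 6 * (dil ((1/5) ^ m) alpha_quot * Phi B x) $ (n - 1))"
proof -
  have "(\<Sum>y | adjacent q m x y. Phi B y $ n - Phi B x $ n) = (\<Sum>y | adjacent q m x y. Phi B y - Phi B x) $ n"
    by (simp add: fps_sum_nth)
  also have "\<dots> = (fps_const (4 * (1/5) ^ m) * (fps_X * (dil ((1/5) ^ m) alpha_quot * Phi B x))) $ n"
    unfolding sum_adjacent_Phi [OF assms] dil_alpha_fps_minus_1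
    by (simp add: numeral_fps_const mult_ac flip: fps_const_mult)
  also have "\<dots> = 4 * (1/5) ^ m * (if n = 0 then 0 else (dil ((1/5) ^ m) alpha_quot * Phi B x) $ (n - 1))"
    by (simp add: fps_X_mult_nth)
  finally show ?thesis
    unfolding graph_laplacian_def by (simp add: power_divide)
qed

lemma Phi_bounded: obtains C where "\<And>x. x \<in> gasket q \<Longrightarrow> \<bar>Phi B x $ n\<bar> \<le> C"
proof -
  have "bounded ((\<lambda>x. Phi B x $ n) ` gasket q)"
    by (intro compact_imp_bounded compact_continuous_image compact_gasket continuous_on_Phi)
  then show thesis
    using that by (auto simp: bounded_iff)
qed

text \<open>In the product with \<open>dil ((1/5) ^ m) alpha_quot\<close> the constant term
  contributes 6 * 1/6 = 1 times the previous coefficient; the finitely many other terms are bounded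
  on the gasket and carry a factor of at most 5^(-m).\<close>

lemma has_laplacian_Phi:
  "has_laplacian q (\<lambda>x. Phi B x $ n) (\<lambda>x. if n = 0 then 0 else Phi B x $ (n - 1))"
  unfolding has_laplacian_def
proof (intro conjI allI impI)
  show "continuous_on (gasket q) (\<lambda>x. Phi B x $ n)"
    by (rule continuous_on_Phi)
  show "continuous_on (gasket q) (\<lambda>x. if n = 0 then 0 else Phi B x $ (n - 1))"
    by (cases n) (simp_all add: continuous_on_Phi)
  fix e :: real assume e: "e > 0"
  show "\<exists>M. \<forall>m\<ge>M. \<forall>x\<in>vertices q m - vertices q 0.
      \<bar>graph_laplacian q m (\<lambda>x. Phi B x $ n) x - (if n = 0 then 0 else Phi B x $ (n - 1))\<bar> < e"
  proof (cases n)
    case 0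
    then show ?thesis using e by (simp add: graph_laplacian_Phi)
  next
    case (Suc k)
    have "\<exists>C. \<forall>x\<in>gasket q. \<bar>Phi B x $ i\<bar> \<le> C" for i
      by (rule Phi_bounded) blast
    then obtain C where C: "\<And>i x. x \<in> gasket q \<Longrightarrow> \<bar>Phi B x $ i\<bar> \<le> C i"
      by metis
    define D where "D = (\<Sum>i=1..k. 6 * (\<bar>alpha_quot $ i\<bar> * C (k - i)))"
    have bound: "\<bar>graph_laplacian q m (\<lambda>x. Phi B x $ n) x - Phi B x $ k\<bar> \<le> (1/5) ^ m * D"
      if x: "x \<in> vertices q m - vertices q 0" for m x
    proof -
      let ?t = "\<lambda>i. ((1/5) ^ m) ^ i * alpha_quot $ i * Phi B x $ (k - i)"
      have xK: "x \<in> gasket q"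
        using x vertices_subset_gasket by blast
      have "graph_laplacian q m (\<lambda>x. Phi B x $ n) x = 6 * (\<Sum>i=0..k. ?t i)"
        by (simp add: graph_laplacian_Phi [OF x] Suc fps_mult_nth)
      also have "(\<Sum>i=0..k. ?t i) = ?t 0 + (\<Sum>i=1..k. ?t i)"
        by (simp add: sum.atLeast_Suc_atMost)
      finally have "graph_laplacian q m (\<lambda>x. Phi B x $ n) x - Phi B x $ k = (\<Sum>i=1..k. 6 * ?t i)"
        by (simp add: sum_distrib_left)
      also have "\<bar>\<dots>\<bar> \<le> (\<Sum>i=1..k. (1/5) ^ m * (6 * (\<bar>alpha_quot $ i\<bar> * C (k - i))))"
      proof (rule order_trans [OF sum_abs], rule sum_mono)
        fix i assume "i \<in> {1..k}"
        then have "((1/5::real) ^ m) ^ i \<le> ((1/5) ^ m) ^ 1"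
          by (intro power_decreasing) (auto simp: power_le_one)
        moreover have "\<bar>alpha_quot $ i\<bar> * \<bar>Phi B x $ (k - i)\<bar> \<le> \<bar>alpha_quot $ i\<bar> * C (k - i)"
          by (intro mult_left_mono C xK) simp
        ultimately have "((1/5::real) ^ m) ^ i * (\<bar>alpha_quot $ i\<bar> * \<bar>Phi B x $ (k - i)\<bar>) \<le> ((1/5) ^ m) ^ 1 * (\<bar>alpha_quot $ i\<bar> * C (k - i))"
          by (rule mult_mono) auto
        then show "\<bar>6 * ?t i\<bar> \<le> (1/5) ^ m * (6 * (\<bar>alpha_quot $ i\<bar> * C (k - i)))"
          by (simp add: abs_mult mult_ac)
      qed
      finally show ?thesis
        by (simp add: D_def sum_distrib_left)
    qed
    have "(\<lambda>m. (1/5) ^ m * D) \<longlonglongrightarrow> 0 * D"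
      by (intro tendsto_intros LIMSEQ_power_zero) simp
    then have "\<forall>\<^sub>F m in sequentially. (1/5) ^ m * D < e"
      using e by (intro order_tendstoD) simp_all
    then obtain M where "\<And>m. m \<ge> M \<Longrightarrow> (1/5) ^ m * D < e"
      by (auto simp: eventually_sequentially)
    then show ?thesis
      using bound Suc by (auto intro!: exI [of _ M] intro: le_less_trans)
  qed
qed

section \<open>Uniqueness\<close>

lemma gasket_eq_closure_interior_vertices:
  "gasket q = closure (\<Union>m. vertices q m - vertices q 0)"
proof
  have "(\<Union>m. vertices q m - vertices q 0) \<subseteq> gasket q"
    using vertices_subset_gasket by blast
  then show "closure (\<Union>m. vertices q m - vertices q 0) \<subseteq> gasket q"
    by (simp add: closure_minimal compact_gasket compact_imp_closed)
qed (rule gasket_subset_closure_interior_vertices)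

lemma zero_on_gasket:
  fixes f :: "real^2 \<Rightarrow> real"
  assumes "continuous_on (gasket q) f" "\<And>m x. x \<in> vertices q m - vertices q 0 \<Longrightarrow> f x = 0" "x \<in> gasket q"
  shows "f x = 0"
proof (rule continuous_constant_on_closure [of "\<Union>m. vertices q m - vertices q 0"])
  show "continuous_on (closure (\<Union>m. vertices q m - vertices q 0)) f"
    using assms(1) unfolding gasket_eq_closure_interior_vertices .
  show "x \<in> closure (\<Union>m. vertices q m - vertices q 0)"
    using assms(3) unfolding gasket_eq_closure_interior_vertices .
qed (use assms(2) in blast)

section \<open>Linearity and uniqueness of the Laplacian\<close>

lemma has_laplacian_continuous:
  assumes "has_laplacian q u f"
  shows "continuous_on (gasket q) u" "continuous_on (gasket q) f"
  using assms by (simp_all add: has_laplacian_def)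

lemma has_laplacianD:
  assumes "has_laplacian q u f" "e > 0"
  shows "\<exists>M. \<forall>m\<ge>M. \<forall>x\<in>vertices q m - vertices q 0. \<bar>graph_laplacian q m u x - f x\<bar> < e"
  using assms by (simp only: has_laplacian_def)

lemma has_laplacian_cong:
  assumes "has_laplacian q u f" "\<And>x. x \<in> gasket q \<Longrightarrow> u x = u' x" "\<And>x. x \<in> gasket q \<Longrightarrow> f x = f' x"
  shows "has_laplacian q u' f'"
  unfolding has_laplacian_def
proof (intro conjI allI impI)
  show "continuous_on (gasket q) u'" "continuous_on (gasket q) f'"
    using has_laplacian_continuous [OF assms(1)] assms(2,3) by (auto intro: continuous_on_eq)
  have vK: "x \<in> gasket q" if "x \<in> vertices q m - vertices q 0" for x m
    using that vertices_subset_gasket by blast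
  have eq: "graph_laplacian q m u x = graph_laplacian q m u' x" if "x \<in> vertices q m - vertices q 0" for m x
    unfolding graph_laplacian_def
    by (intro arg_cong2 [where f = "(*)"] refl sum.cong arg_cong2 [where f = "(-)"] assms(2) vK [OF that])
      (simp add: adjacent_in_gasket(2))
  fix e :: real assume "e > 0"
  obtain M where M: "\<And>m x. m \<ge> M \<Longrightarrow> x \<in> vertices q m - vertices q 0 \<Longrightarrow> \<bar>graph_laplacian q m u x - f x\<bar> < e"
    using has_laplacianD [OF assms(1) \<open>e > 0\<close>] by blast
  show "\<exists>M. \<forall>m\<ge>M. \<forall>x\<in>vertices q m - vertices q 0. \<bar>graph_laplacian q m u' x - f' x\<bar> < e"
  proof (intro exI allI impI ballI)
    fix m x assume "m \<ge> M" and x: "x \<in> vertices q m - vertices q 0"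
    with M have "\<bar>graph_laplacian q m u x - f x\<bar> < e" by blast
    then show "\<bar>graph_laplacian q m u' x - f' x\<bar> < e"
      by (simp only: eq [OF x] assms(3) [OF vK [OF x]])
  qed
qed

lemma graph_laplacian_add_scaled:
  "graph_laplacian q m (\<lambda>x. u x + c * v x) x = graph_laplacian q m u x + c * graph_laplacian q m v x"
proof -
  have "(u y + c * v y) - (u x + c * v x) = (u y - u x) + c * (v y - v x)" for y
    by (simp add: algebra_simps)
  then show ?thesis
    unfolding graph_laplacian_def
    by (simp only: sum.distrib distrib_left mult.left_commute sum_distrib_left [symmetric])
qed

lemma has_laplacian_add_scaled:
  assumes "has_laplacian q u f" "has_laplacian q v g"
  shows "has_laplacian q (\<lambda>x. u x + c * v x) (\<lambda>x. f x + c * g x)"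
  unfolding has_laplacian_def
proof (intro conjI allI impI)
  show "continuous_on (gasket q) (\<lambda>x. u x + c * v x)" "continuous_on (gasket q) (\<lambda>x. f x + c * g x)"
    by (intro continuous_intros has_laplacian_continuous [OF assms(1)] has_laplacian_continuous [OF assms(2)])+
  fix e :: real assume e: "e > 0"
  \<comment> \<open>The tolerance for both functions, chosen so that the errors d and \<bar>c\<bar>
    d add up to e.\<close>
  define d where "d = e / (\<bar>c\<bar> + 1)"
  have d: "d > 0" "d + \<bar>c\<bar> * d = e"
  proof -
    have "\<bar>c\<bar> + 1 > 0" by simp
    then show "d > 0" using e by (simp add: d_def)
    have "d + \<bar>c\<bar> * d = d * (\<bar>c\<bar> + 1)" by (simp add: algebra_simps)
    also have "\<dots> = e" using \<open>\<bar>c\<bar> + 1 > 0\<close> by (simp add: d_def)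
    finally show "d + \<bar>c\<bar> * d = e" .
  qed
  obtain M where M: "\<And>m x. m \<ge> M \<Longrightarrow> x \<in> vertices q m - vertices q 0 \<Longrightarrow> \<bar>graph_laplacian q m u x - f x\<bar> < d"
    using has_laplacianD [OF assms(1) d(1)] by blast
  obtain N where N: "\<And>m x. m \<ge> N \<Longrightarrow> x \<in> vertices q m - vertices q 0 \<Longrightarrow> \<bar>graph_laplacian q m v x - g x\<bar> < d"
    using has_laplacianD [OF assms(2) d(1)] by blast
  have "\<bar>graph_laplacian q m (\<lambda>x. u x + c * v x) x - (f x + c * g x)\<bar> < e"
    if "m \<ge> max M N" "x \<in> vertices q m - vertices q 0" for m x
  proof -
    have "graph_laplacian q m (\<lambda>x. u x + c * v x) x - (f x + c * g x) =
        (graph_laplacian q m u x - f x) + c * (graph_laplacian q m v x - g x)"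
      unfolding graph_laplacian_add_scaled by (simp add: algebra_simps)
    also have "\<bar>\<dots>\<bar> \<le> \<bar>graph_laplacian q m u x - f x\<bar> + \<bar>c\<bar> * \<bar>graph_laplacian q m v x - g x\<bar>"
      by (rule order_trans [OF abs_triangle_ineq]) (simp add: abs_mult)
    also have "\<dots> < d + \<bar>c\<bar> * d"
      using M [of m x] N [of m x] that by (intro add_less_le_mono mult_left_mono) auto
    finally show ?thesis
      unfolding d(2) .
  qed
  then show "\<exists>M. \<forall>m\<ge>M. \<forall>x\<in>vertices q m - vertices q 0.
      \<bar>graph_laplacian q m (\<lambda>x. u x + c * v x) x - (f x + c * g x)\<bar> < e"
    by (intro exI [of _ "max M N"] allI ballI impI)
qed

lemma has_laplacian_unique:
  assumes "has_laplacian q u f" "has_laplacian q u g" "x \<in> gasket q"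
  shows "f x = g x"
proof -
  have "f x - g x = 0"
  proof (rule zero_on_gasket [OF _ _ assms(3)])
    show "continuous_on (gasket q) (\<lambda>x. f x - g x)"
      by (intro continuous_intros has_laplacian_continuous [OF assms(1)] has_laplacian_continuous [OF assms(2)])
    fix k x assume x: "x \<in> vertices q k - vertices q 0"
    have "\<bar>f x - g x\<bar> \<le> e" if "e > 0" for e
    proof -
      have "e/2 > 0" using that by simp
      obtain M where M: "\<And>m x. m \<ge> M \<Longrightarrow> x \<in> vertices q m - vertices q 0 \<Longrightarrow> \<bar>graph_laplacian q m u x - f x\<bar> < e/2"
        using has_laplacianD [OF assms(1) \<open>e/2 > 0\<close>] by blast
      obtain N where N: "\<And>m x. m \<ge> N \<Longrightarrow> x \<in> vertices q m - vertices q 0 \<Longrightarrow> \<bar>graph_laplacian q m u x - g x\<bar> < e/2"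
        using has_laplacianD [OF assms(2) \<open>e/2 > 0\<close>] by blast
      define m where "m = max k (max M N)"
      have "x \<in> vertices q m - vertices q 0"
        using x vertices_mono' [of k m q] by (auto simp: m_def)
      then have "\<bar>graph_laplacian q m u x - f x\<bar> < e/2" "\<bar>graph_laplacian q m u x - g x\<bar> < e/2"
        using M [of m x] N [of m x] by (simp_all add: m_def)
      then show ?thesis by linarith
    qed
    then have "\<bar>f x - g x\<bar> \<le> 0"
      by (rule field_le_epsilon [of _ 0, simplified])
    then show "f x - g x = 0" by simp
  qed
  then show ?thesis by simp
qed

lemma laplacian_eq:
  assumes "has_laplacian q u f"
  shows "laplacian q u = (\<lambda>x. if x \<in> gasket q then f x else 0)"
  unfolding laplacian_def
proof (rule the_equality, intro conjI allI impI)
  show "has_laplacian q u (\<lambda>x. if x \<in> gasket q then f x else 0)"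
    by (rule has_laplacian_cong [OF assms]) simp_all
  fix g assume "has_laplacian q u g \<and> (\<forall>x. x \<notin> gasket q \<longrightarrow> g x = 0)"
  then show "g = (\<lambda>x. if x \<in> gasket q then f x else 0)"
    using has_laplacian_unique [OF assms, of g] by (intro ext) simp
qed simp

text \<open>At every sufficiently fine level the graph Laplacian is positive at all non-corner
  vertices. It is nonpositive at a vertex where the maximum over that level is attained, so that
  vertex is a corner; density extends the bound.\<close>

lemma maximum_principle:
  assumes "has_laplacian q u f" "d > 0" "\<And>x. x \<in> gasket q \<Longrightarrow> f x \<ge> d" "\<And>i. u (q i) \<le> c" "x \<in> gasket q"
  shows "u x \<le> c"
proof -
  obtain M where M: "\<And>m x. m \<ge> M \<Longrightarrow> x \<in> vertices q m - vertices q 0 \<Longrightarrow> \<bar>graph_laplacian q m u x - f x\<bar> < d"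
    using has_laplacianD [OF assms(1,2)] by blast
  have large: "u y \<le> c" if "m \<ge> M" "y \<in> vertices q m" for m y
  proof -
    have fin: "finite (u ` vertices q m)" "u ` vertices q m \<noteq> {}"
      using finite_vertices that(2) by auto
    then obtain z where z: "z \<in> vertices q m" "u z = Max (u ` vertices q m)"
      using Max_in by (metis (no_types, lifting) imageE)
    then have le: "u y \<le> u z" if "y \<in> vertices q m" for y
      using that fin by simp
    have "z \<in> vertices q 0"
    proof (rule ccontr)
      assume "z \<notin> vertices q 0"
      then have z': "z \<in> vertices q m - vertices q 0"
        using z(1) by simp
      have "f z \<ge> d"
        using assms(3) z(1) vertices_subset_gasket by blast
      then have "graph_laplacian q m u z > 0"
        using M [OF \<open>m \<ge> M\<close> z'] by linarith
      moreover have "(\<Sum>y | adjacent q m z y. u y - u z) \<le> 0"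
        by (intro sum_nonpos) (simp add: le adjacent_def)
      then have "graph_laplacian q m u z \<le> 0"
        unfolding graph_laplacian_def by (intro mult_nonneg_nonpos) simp_all
      ultimately show False by simp
    qed
    then have "u z \<le> c"
      using assms(4) by auto
    then show ?thesis
      using le [OF that(2)] by simp
  qed
  have "u y \<le> c" if y: "y \<in> all_vertices q" for y
  proof -
    obtain k where "y \<in> vertices q k"
      using y unfolding all_vertices_def by (elim UN_E)
    then have "y \<in> vertices q (max k M)"
      using vertices_mono' [of k "max k M" q] by auto
    then show ?thesis
      by (rule large [rotated]) simp
  qed
  moreover have "continuous_on (closure (all_vertices q)) u"
    using has_laplacian_continuous(1) [OF assms(1)] unfolding gasket_eq_closure .
  ultimately show ?thesis
    using assms(5) unfolding gasket_eq_closure by (intro continuous_le_on_closure [of "all_vertices q" u x c])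
qed

lemma Phi_one_0: "x \<in> gasket q \<Longrightarrow> Phi (\<lambda>_. 1) x $ 0 = 1"
proof -
  \<comment> \<open>The lowest coefficient sees only the lowest coefficients of the corner values,
    and harmonic extension preserves constants.\<close>
  have 0: "Phi B x $ 0 = Phi B' x $ 0" if "\<And>l. B l $ 0 = B' l $ 0" for B B' x
    unfolding Phi_def using that by (simp add: fps_sum_nth)
  have V: "Phi (\<lambda>_. 1) x $ 0 = 1" if "x \<in> vertices q m" for m x
    using that
  proof (induction m arbitrary: x)
    case (Suc m)
    then obtain i y where y: "y \<in> vertices q m" "x = contr q i y"
      by auto
    then have "y \<in> gasket q"
      using vertices_subset_gasket by blast
    then have "Phi (\<lambda>_. 1) x $ 0 = Phi (cell_data (\<lambda>_. 1) i) y $ 0"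
      by (simp add: y Phi_cell_data)
    also have "\<dots> = Phi (\<lambda>_. 1) y $ 0"
      by (rule 0) (simp add: cell_data_def ext_def)
    finally show ?case
      using Suc.IH [OF y(1)] by simp
  qed auto
  have 1: "Phi (\<lambda>_. 1) x $ 0 - 1 = 0" if "x \<in> vertices q m - vertices q 0" for m x
    using V [of x m] that by simp
  have 2: "continuous_on (gasket q) (\<lambda>x. Phi (\<lambda>_. 1) x $ 0 - 1)"
    by (intro continuous_intros continuous_on_Phi)
  have "x \<in> gasket q \<Longrightarrow> Phi (\<lambda>_. 1) x $ 0 - 1 = 0"
    by (rule zero_on_gasket [where f = "\<lambda>x. Phi (\<lambda>_. 1) x $ 0 - 1", OF 2 1])
  then show "x \<in> gasket q \<Longrightarrow> Phi (\<lambda>_. 1) x $ 0 = 1"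
    by simp
qed

text \<open>
  The maximum principle needs a strictly positive Laplacian, which is gained by adding a small
  multiple of a function with Laplacian 1.
\<close>

lemma dirichlet_unique:
  assumes "has_laplacian q u f" "\<And>x. x \<in> gasket q \<Longrightarrow> f x = 0" "\<And>i. u (q i) = 0" "x \<in> gasket q"
  shows "u x = 0"
proof -
  have le: "s * u x \<le> 0" for s
  proof (rule ccontr)
    define w where "w = (\<lambda>x. Phi (\<lambda>_. 1) x $ 1)"
    \<comment> \<open>Small enough that adding \<open>e * w\<close> cannot destroy the positive
      value \<open>s * u x\<close>; the factor \<open>s\<close>, later 1 and -1, treats both signs
      at once.\<close>
    define e where "e = s * u x / (2 * (\<bar>w x\<bar> + 1))"
    assume "\<not> s * u x \<le> 0"
    then have su: "s * u x > 0" by simp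
    then have e: "e > 0"
      by (simp add: e_def add_nonneg_pos)
    have w: "has_laplacian q w (\<lambda>x. 1)"
      by (rule has_laplacian_cong [OF has_laplacian_Phi [of "\<lambda>_. 1" 1]]) (simp_all add: w_def Phi_one_0)
    \<comment> \<open>The multiple \<open>e * w\<close> is obtained as
      \<open>w + (e - 1) * w\<close>, the form that \<open>has_laplacian_add_scaled\<close>
      provides.\<close>
    have "has_laplacian q (\<lambda>x. e * w x + s * u x) (\<lambda>x. e)"
      by (rule has_laplacian_cong [OF has_laplacian_add_scaled [OF has_laplacian_add_scaled [OF w w, of "e - 1"] assms(1), of s]])
        (simp_all add: assms(2) algebra_simps)
    then have "e * w x + s * u x \<le> 0"
      by (rule maximum_principle [OF _ e _ _ assms(4)]) (simp_all add: w_def assms(3))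
    moreover have "- (e * w x) \<le> e * \<bar>w x\<bar>"
      using e by (metis abs_ge_minus_self abs_mult abs_of_pos)
    moreover have "e * \<bar>w x\<bar> < e * (2 * (\<bar>w x\<bar> + 1))"
      using e by (intro mult_strict_left_mono) auto
    moreover have "e * (2 * (\<bar>w x\<bar> + 1)) = s * u x"
    proof -
      have "2 * (\<bar>w x\<bar> + 1) \<noteq> 0" by (simp add: add_nonneg_eq_0_iff)
      then show ?thesis unfolding e_def by (rule nonzero_eq_divide_eq [THEN iffD1, OF _ refl])
    qed
    ultimately show False by linarith
  qed
  show ?thesis
    using le [of 1] le [of "-1"] by simp
qed

text \<open>At each index the difference from the eigenfunction coefficient has Laplacian 0 by the
  previous index and vanishes at the corners, so \<open>dirichlet_unique\<close> applies.\<close>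

lemma laplacian_chain_eq_Phi:
  assumes "\<And>n. n < N \<Longrightarrow> has_laplacian q (v (Suc n)) (v n)" "has_laplacian q (v 0) f"
    "\<And>x. x \<in> gasket q \<Longrightarrow> f x = 0" "\<And>l n. n \<le> N \<Longrightarrow> B l $ n = v n (q l)" "n \<le> N" "x \<in> gasket q"
  shows "v n x = Phi B x $ n"
  using assms(5,6)
proof (induction n arbitrary: x)
  case 0
  have "v 0 x + (-1) * Phi B x $ 0 = 0"
    by (rule dirichlet_unique [where u = "\<lambda>x. v 0 x + (-1) * Phi B x $ 0", OF has_laplacian_add_scaled [OF assms(2) has_laplacian_Phi]])
      (simp_all add: assms(3,4) 0)
  then show ?case by simp
next
  case (Suc n)
  have "v (Suc n) x + (-1) * Phi B x $ Suc n = 0"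
    by (rule dirichlet_unique [where u = "\<lambda>x. v (Suc n) x + (-1) * Phi B x $ Suc n", OF has_laplacian_add_scaled [OF assms(1) has_laplacian_Phi]])
      (use Suc in \<open>simp_all add: assms(4)\<close>)
  then show ?case by simp
qed

text \<open>The Laplacian lowers the coefficient index by one; past index 0 it continues with the
  zero function, which is the eigenfunction with zero corner values.\<close>

lemma laplacian_funpow_Phi:
  assumes "\<And>x. x \<in> gasket q \<Longrightarrow> u x = Phi B x $ n" "x \<in> gasket q"
  shows "(laplacian q ^^ i) u x = (if i \<le> n then Phi B x $ (n - i) else 0)"
  using assms(2)
proof (induction i arbitrary: x)
  case (Suc i)
  have "has_laplacian q ((laplacian q ^^ i) u) (\<lambda>x. if Suc i \<le> n then Phi B x $ (n - Suc i) else 0)"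
  proof (cases "i \<le> n")
    case True
    show ?thesis
      by (rule has_laplacian_cong [OF has_laplacian_Phi [of B "n - i"]]) (use True Suc.IH in auto)
  next
    case False
    show ?thesis
      by (rule has_laplacian_cong [OF has_laplacian_Phi [of "\<lambda>_. 0" 0]]) (use False Suc.IH in \<open>auto simp: Phi_def\<close>)
  qed
  then show ?case
    using laplacian_eq Suc.prems by simp
qed (use assms(1) in simp)

lemma has_laplacian_laplacian:
  assumes "u \<in> dom_laplacian q"
  shows "has_laplacian q u (laplacian q u)"
proof -
  obtain f where "has_laplacian q u f"
    using assms by (auto simp: dom_laplacian_def)
  then show ?thesis
    by (rule has_laplacian_cong) (simp_all add: laplacian_eq [OF \<open>has_laplacian q u f\<close>])
qed

lemma polyharmonic_eq_Phi:
  assumes "u \<in> polyharmonic q j"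
  shows "\<exists>B. \<forall>x\<in>gasket q. u x = Phi B x $ j"
proof -
  have dom: "(laplacian q ^^ i) u \<in> dom_laplacian q" if "i \<le> j" for i
    using assms that by (simp add: polyharmonic_def)
  have zero: "(laplacian q ^^ Suc j) u x = 0" if "x \<in> gasket q" for x
    using assms that by (simp only: polyharmonic_def mem_Collect_eq)
  \<comment> \<open>Reversing the order of the iterated Laplacians gives a chain in which the
    Laplacian of \<open>v (Suc n)\<close> is \<open>v n\<close> for n < j, and which reaches
    \<open>u\<close> at j.\<close>
  define v where "v = (\<lambda>n. (laplacian q ^^ (j - n)) u)"
  define B where "B = (\<lambda>l. Abs_fps (\<lambda>n. v n (q l)))"
  have step: "has_laplacian q ((laplacian q ^^ i) u) ((laplacian q ^^ Suc i) u)" if "i \<le> j" for i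
    using has_laplacian_laplacian [OF dom [OF that]] by simp
  have "v j x = Phi B x $ j" if "x \<in> gasket q" for x
  proof (rule laplacian_chain_eq_Phi [where f = "(laplacian q ^^ Suc j) u" and N = j])
    show "has_laplacian q (v 0) ((laplacian q ^^ Suc j) u)"
      using step [of j] by (simp add: v_def)
    show "has_laplacian q (v (Suc n)) (v n)" if "n < j" for n
      using step [of "j - Suc n"] that by (simp add: v_def Suc_diff_Suc del: funpow.simps)
  qed (use that zero in \<open>simp_all add: B_def del: funpow.simps\<close>)
  then show ?thesis
    by (intro exI [of _ B]) (simp add: v_def)
qed

section \<open>Dependence of the derivatives on the values on the gasket\<close>

lemma has_normal_deriv_cong:
  assumes "\<And>x. x \<in> gasket q \<Longrightarrow> u x = v x"
  shows "has_normal_deriv q u j d \<longleftrightarrow> has_normal_deriv q v j d"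
  unfolding has_normal_deriv_def by (simp add: assms)

lemma has_tangential_deriv_cong:
  assumes "\<And>x. x \<in> gasket q \<Longrightarrow> u x = v x"
  shows "has_tangential_deriv q u j d \<longleftrightarrow> has_tangential_deriv q v j d"
  unfolding has_tangential_deriv_def by (simp add: assms)

lemma has_normal_deriv_unique: "has_normal_deriv q u j d \<Longrightarrow> has_normal_deriv q u j d' \<Longrightarrow> d = d'"
  unfolding has_normal_deriv_def by (rule LIMSEQ_unique)

lemma has_tangential_deriv_unique: "has_tangential_deriv q u j d \<Longrightarrow> has_tangential_deriv q u j d' \<Longrightarrow> d = d'"
  unfolding has_tangential_deriv_def by (rule LIMSEQ_unique)

lemma normal_deriv_eq: "has_normal_deriv q u j d \<Longrightarrow> normal_deriv q u j = d"
  unfolding normal_deriv_def using has_normal_deriv_unique by (intro the_equality)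

lemma tangential_deriv_eq: "has_tangential_deriv q u j d \<Longrightarrow> tangential_deriv q u j = d"
  unfolding tangential_deriv_def using has_tangential_deriv_unique by (intro the_equality)

section \<open>Monomials and the matching condition\<close>

text \<open>Value, normal and tangential derivative at \<open>q 0\<close> depend on the corner
  values through a linear system that is invertible over power series, since 2,
  \<open>normal_fps\<close> and \<open>tangential_fps\<close> are units. So it can be solved modulo
  \<lambda>^(n+1).\<close>

lemma jet_vanishes:
  fixes D :: "3 \<Rightarrow> real fps"
  assumes "vanishes n (D 0)" "vanishes n (normal_fps * (2 * alpha_fps * D 0 - (D (0 + 1) + D (0 - 1))))"
    "vanishes n (tangential_fps * (D (0 + 1) - D (0 - 1)))"
  shows "vanishes n (D l)"
proof -
  have 1: "vanishes n (2 * alpha_fps * D 0 - (D (0 + 1) + D (0 - 1)))"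
    by (rule vanishes_unit_cancel [OF _ assms(2)]) simp
  have 2: "vanishes n (D (0 + 1) - D (0 - 1))"
    by (rule vanishes_unit_cancel [OF _ assms(3)]) simp
  have 3: "vanishes n (2 * alpha_fps * D 0 - (2 * alpha_fps * D 0 - (D (0 + 1) + D (0 - 1))))"
    by (intro vanishes_diff vanishes_mult assms(1) 1)
  have 4: "2 * D (0 + 1) = (2 * alpha_fps * D 0 - (2 * alpha_fps * D 0 - (D (0 + 1) + D (0 - 1)))) + (D (0 + 1) - D (0 - 1))"
    "2 * D (0 - 1) = (2 * alpha_fps * D 0 - (2 * alpha_fps * D 0 - (D (0 + 1) + D (0 - 1)))) - (D (0 + 1) - D (0 - 1))"
    by algebra+
  have "vanishes n (2 * D (0 + 1))" "vanishes n (2 * D (0 - 1))"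
    unfolding 4 by (intro vanishes_add vanishes_diff 2 3)+
  then have "vanishes n (D (0 + 1))" "vanishes n (D (0 - 1))"
    by (auto elim!: vanishes_unit_cancel [rotated])
  then show ?thesis
    using three_cases [of l 0] assms(1) by (elim disjE) simp_all
qed

lemma Phi_diff: "Phi B x - Phi B' x = Phi (\<lambda>l. B l - B' l) x"
  by (simp add: Phi_def left_diff_distrib sum_subtractf)

lemma Phi_vanishes: "(\<And>l. vanishes n (B l)) \<Longrightarrow> vanishes n (Phi B x)"
  unfolding Phi_def
  by (intro vanishes_sum vanishes_mult' )

text \<open>A jet at \<open>q 0\<close> equal to the constant series 0 or 1 encodes the Kronecker
  conditions for all degrees simultaneously, so one \<open>B\<close> serves every \<open>j\<close>.
  Any other candidate is also a coefficient of some \<open>Phi B'\<close>, with the same jet up to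
  order \<open>j\<close>, and \<open>jet_vanishes\<close> applies to the difference.\<close>

lemma monomial_eq_Phi:
  assumes "B 0 = of_bool (k = 1)" "normal_fps * (2 * alpha_fps * B 0 - (B (0 + 1) + B (0 - 1))) = of_bool (k = 2)"
    "tangential_fps * (B (0 + 1) - B (0 - 1)) = of_bool (k = 3)"
  shows "monomial q j k = (\<lambda>x. if x \<in> gasket q then Phi B x $ j else 0)" (is "_ = ?u")
  unfolding monomial_def
proof (rule the_equality)
  have iter: "(laplacian q ^^ i) ?u x = (if i \<le> j then Phi B x $ (j - i) else 0)" if "x \<in> gasket q" for i x
    by (rule laplacian_funpow_Phi [OF _ that]) simp
  have "(laplacian q ^^ i) ?u \<in> dom_laplacian q" if "i \<le> j" for i
  proof -
    have "has_laplacian q ((laplacian q ^^ i) ?u) (\<lambda>x. if j - i = 0 then 0 else Phi B x $ (j - i - 1))"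
      by (rule has_laplacian_cong [OF has_laplacian_Phi [of B "j - i"]]) (simp_all add: iter that)
    then show ?thesis
      unfolding dom_laplacian_def by blast
  qed
  moreover have "(laplacian q ^^ Suc j) ?u x = 0" if "x \<in> gasket q" for x
    using iter [OF that, of "Suc j"] by simp
  ultimately have "?u \<in> polyharmonic q j"
    unfolding polyharmonic_def by (simp del: funpow.simps)
  moreover have "(laplacian q ^^ m) ?u (q 0) = of_bool (m = j \<and> k = 1)" if "m \<le> j" for m
    using that by (simp add: iter assms(1) of_bool_def)
  moreover have "has_normal_deriv q ((laplacian q ^^ m) ?u) 0 (of_bool (m = j \<and> k = 2))" if "m \<le> j" for m
  proof -
    have "has_normal_deriv q ((laplacian q ^^ m) ?u) 0 ((of_bool (k = 2) :: real fps) $ (j - m))"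
      using has_normal_deriv_Phi [of B "j - m" 0] unfolding assms(2)
      by (subst has_normal_deriv_cong [where v = "\<lambda>x. Phi B x $ (j - m)"]) (simp_all add: iter that)
    then show ?thesis
      using that by (auto simp: of_bool_def split: if_splits)
  qed
  moreover have "has_tangential_deriv q ((laplacian q ^^ m) ?u) 0 (of_bool (m = j \<and> k = 3))" if "m \<le> j" for m
  proof -
    have "has_tangential_deriv q ((laplacian q ^^ m) ?u) 0 ((of_bool (k = 3) :: real fps) $ (j - m))"
      using has_tangential_deriv_Phi [of B "j - m" 0] unfolding assms(3)
      by (subst has_tangential_deriv_cong [where v = "\<lambda>x. Phi B x $ (j - m)"]) (simp_all add: iter that)
    then show ?thesis
      using that by (auto simp: of_bool_def split: if_splits)
  qed
  ultimately show u: "?u \<in> polyharmonic q j \<and> (\<forall>x. x \<notin> gasket q \<longrightarrow> ?u x = 0) \<and>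
     (\<forall>m\<le>j. (laplacian q ^^ m) ?u (q 0) = of_bool (m = j \<and> k = 1) \<and>
        has_normal_deriv q ((laplacian q ^^ m) ?u) 0 (of_bool (m = j \<and> k = 2)) \<and>
        has_tangential_deriv q ((laplacian q ^^ m) ?u) 0 (of_bool (m = j \<and> k = 3)))"
    by (intro conjI allI impI) simp_all
  fix v assume v: "v \<in> polyharmonic q j \<and> (\<forall>x. x \<notin> gasket q \<longrightarrow> v x = 0) \<and>
     (\<forall>m\<le>j. (laplacian q ^^ m) v (q 0) = of_bool (m = j \<and> k = 1) \<and>
        has_normal_deriv q ((laplacian q ^^ m) v) 0 (of_bool (m = j \<and> k = 2)) \<and>
        has_tangential_deriv q ((laplacian q ^^ m) v) 0 (of_bool (m = j \<and> k = 3)))"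
  then have "v \<in> polyharmonic q j" by (rule conjunct1)
  from polyharmonic_eq_Phi [OF this] obtain B' where B': "\<And>x. x \<in> gasket q \<Longrightarrow> v x = Phi B' x $ j"
    by blast
  have iter': "(laplacian q ^^ i) v x = (if i \<le> j then Phi B' x $ (j - i) else 0)" if "x \<in> gasket q" for i x
    by (rule laplacian_funpow_Phi [OF B' that])
  have jet: "B 0 $ (j - m) = B' 0 $ (j - m) \<and>
      (normal_fps * (2 * alpha_fps * B 0 - (B (0 + 1) + B (0 - 1)))) $ (j - m) = (normal_fps * (2 * alpha_fps * B' 0 - (B' (0 + 1) + B' (0 - 1)))) $ (j - m) \<and>
      (tangential_fps * (B (0 + 1) - B (0 - 1))) $ (j - m) = (tangential_fps * (B' (0 + 1) - B' (0 - 1))) $ (j - m)"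
    if "m \<le> j" for m
  proof (intro conjI)
    have U: "(laplacian q ^^ m) ?u (q 0) = of_bool (m = j \<and> k = 1)"
        "has_normal_deriv q ((laplacian q ^^ m) ?u) 0 (of_bool (m = j \<and> k = 2))"
        "has_tangential_deriv q ((laplacian q ^^ m) ?u) 0 (of_bool (m = j \<and> k = 3))"
      using u that by blast+
    have V: "(laplacian q ^^ m) v (q 0) = of_bool (m = j \<and> k = 1)"
        "has_normal_deriv q ((laplacian q ^^ m) v) 0 (of_bool (m = j \<and> k = 2))"
        "has_tangential_deriv q ((laplacian q ^^ m) v) 0 (of_bool (m = j \<and> k = 3))"
      using v that by blast+
    have eq: "has_normal_deriv q ((laplacian q ^^ m) ?u) 0 d \<longleftrightarrow> has_normal_deriv q (\<lambda>x. Phi B x $ (j - m)) 0 d"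
      "has_tangential_deriv q ((laplacian q ^^ m) ?u) 0 d \<longleftrightarrow> has_tangential_deriv q (\<lambda>x. Phi B x $ (j - m)) 0 d"
      "has_normal_deriv q ((laplacian q ^^ m) v) 0 d \<longleftrightarrow> has_normal_deriv q (\<lambda>x. Phi B' x $ (j - m)) 0 d"
      "has_tangential_deriv q ((laplacian q ^^ m) v) 0 d \<longleftrightarrow> has_tangential_deriv q (\<lambda>x. Phi B' x $ (j - m)) 0 d" for d
      by (rule has_normal_deriv_cong has_tangential_deriv_cong, simp add: iter iter' that)+
    show "B 0 $ (j - m) = B' 0 $ (j - m)"
      using U(1) V(1) that unfolding iter [OF q_in_gasket] iter' [OF q_in_gasket] Phi_q by simp
    show "(normal_fps * (2 * alpha_fps * B 0 - (B (0 + 1) + B (0 - 1)))) $ (j - m) = (normal_fps * (2 * alpha_fps * B' 0 - (B' (0 + 1) + B' (0 - 1)))) $ (j - m)"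
      using has_normal_deriv_unique [OF has_normal_deriv_Phi U(2) [unfolded eq]]
        has_normal_deriv_unique [OF has_normal_deriv_Phi V(2) [unfolded eq]] by (simp only:)
    show "(tangential_fps * (B (0 + 1) - B (0 - 1))) $ (j - m) = (tangential_fps * (B' (0 + 1) - B' (0 - 1))) $ (j - m)"
      using has_tangential_deriv_unique [OF has_tangential_deriv_Phi U(3) [unfolded eq]]
        has_tangential_deriv_unique [OF has_tangential_deriv_Phi V(3) [unfolded eq]] by (simp only:)
  qed
  have jet': "B 0 $ i = B' 0 $ i \<and>
      (normal_fps * (2 * alpha_fps * B 0 - (B (0 + 1) + B (0 - 1)))) $ i = (normal_fps * (2 * alpha_fps * B' 0 - (B' (0 + 1) + B' (0 - 1)))) $ i \<and>
      (tangential_fps * (B (0 + 1) - B (0 - 1))) $ i = (tangential_fps * (B' (0 + 1) - B' (0 - 1))) $ i"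
    if "i \<le> j" for i
    using jet [of "j - i"] that by simp
  define D where "D = (\<lambda>l. B l - B' l)"
  have "vanishes j (D l)" for l
  proof (rule jet_vanishes)
    show "vanishes j (D 0)"
      using jet' by (simp add: vanishes_def D_def)
    have "normal_fps * (2 * alpha_fps * D 0 - (D (0 + 1) + D (0 - 1))) =
        normal_fps * (2 * alpha_fps * B 0 - (B (0 + 1) + B (0 - 1))) - normal_fps * (2 * alpha_fps * B' 0 - (B' (0 + 1) + B' (0 - 1)))"
      unfolding D_def by algebra
    then show "vanishes j (normal_fps * (2 * alpha_fps * D 0 - (D (0 + 1) + D (0 - 1))))"
      using jet' unfolding vanishes_def by (simp only: fps_sub_nth) simp
    have "tangential_fps * (D (0 + 1) - D (0 - 1)) = tangential_fps * (B (0 + 1) - B (0 - 1)) - tangential_fps * (B' (0 + 1) - B' (0 - 1))"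
      unfolding D_def by algebra
    then show "vanishes j (tangential_fps * (D (0 + 1) - D (0 - 1)))"
      using jet' unfolding vanishes_def by (simp only: fps_sub_nth) simp
  qed
  then have "vanishes j (Phi D x)" for x
    by (rule Phi_vanishes)
  then have "Phi B x $ j = Phi B' x $ j" for x
    unfolding D_def Phi_diff [symmetric] vanishes_def by (metis eq_iff_diff_eq_0 fps_sub_nth order_refl)
  then show "v = ?u"
    using v B' by (intro ext) simp
qed

lemma monomial_1: "monomial q j 1 = (\<lambda>x. if x \<in> gasket q then Phi (\<lambda>l. if l = 0 then 1 else alpha_fps) x $ j else 0)"
  by (rule monomial_eq_Phi) simp_all

text \<open>Symmetry gives equal values c at the other two corners, and the normal derivative 1
  requires -2 c \<open>normal_fps\<close> = 1.\<close>

lemma monomial_2: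
  "monomial q j 2 = (\<lambda>x. if x \<in> gasket q
     then Phi (\<lambda>l. if l = 0 then 0 else fps_const (- 1/2) * inverse normal_fps) x $ j else 0)"
proof (rule monomial_eq_Phi)
  have "normal_fps * inverse normal_fps = 1"
    by (subst mult.commute, rule inverse_mult_eq_1) simp
  moreover have "2 * fps_const (- 1/2) = (- 1 :: real fps)"
    by (simp add: numeral_fps_const)
  ultimately have "normal_fps * (0 - (fps_const (- 1/2) * inverse normal_fps + fps_const (- 1/2) * inverse normal_fps)) = 1"
    by algebra
  then show "normal_fps * (2 * alpha_fps * (if (0::3) = 0 then 0 else fps_const (- 1/2) * inverse normal_fps) -
      ((if (0::3) + 1 = 0 then 0 else fps_const (- 1/2) * inverse normal_fps) +
       (if (0::3) - 1 = 0 then 0 else fps_const (- 1/2) * inverse normal_fps))) = of_bool (2 = (2::nat))"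
    by simp
qed simp_all

section \<open>Identification of the constants\<close>

lemma alpha_eq: "alpha q j = alpha_fps $ j"
  unfolding alpha_def monomial_1 by simp

text \<open>Seen from \<open>q 1\<close> the neighbouring corners have the values \<alpha> and 1,
  and 2 \<alpha>^2 - \<alpha> - 1 = (\<alpha> - 1)(2 \<alpha> + 1).\<close>

lemma nconst_eq: "nconst q j = n_fps $ j"
proof -
  let ?B = "\<lambda>l::3. if l = 0 then 1 else alpha_fps"
  have "has_normal_deriv q (\<lambda>x. Phi ?B x $ j) 1 ((normal_fps * (2 * alpha_fps * ?B 1 - (?B (1 + 1) + ?B (1 - 1)))) $ j)"
    by (rule has_normal_deriv_Phi)
  moreover have "monomial q j 1 x = Phi ?B x $ j" if "x \<in> gasket q" for x
    using that by (simp only: monomial_1 if_True)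
  ultimately have "has_normal_deriv q (monomial q j 1) 1 ((normal_fps * (2 * alpha_fps * ?B 1 - (?B (1 + 1) + ?B (1 - 1)))) $ j)"
    using has_normal_deriv_cong [of "monomial q j 1" "\<lambda>x. Phi ?B x $ j"] by (simp only:)
  then have "nconst q j = (normal_fps * (2 * alpha_fps * ?B 1 - (?B (1 + 1) + ?B (1 - 1)))) $ j"
    unfolding nconst_def by (rule normal_deriv_eq)
  also have "normal_fps * (2 * alpha_fps * ?B 1 - (?B (1 + 1) + ?B (1 - 1))) = n_fps"
    by (simp add: n_fps_def algebra_simps)
  finally show ?thesis .
qed

lemma tconst_eq: "tconst q j = t_fps $ j"
proof -
  let ?B = "\<lambda>l::3. if l = 0 then 0 else fps_const (- 1/2) * inverse normal_fps"
  have "has_tangential_deriv q (\<lambda>x. Phi ?B x $ j) 1 ((tangential_fps * (?B (1 + 1) - ?B (1 - 1))) $ j)"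
    by (rule has_tangential_deriv_Phi)
  moreover have "monomial q j 2 x = Phi ?B x $ j" if "x \<in> gasket q" for x
    using that by (simp only: monomial_2 if_True)
  ultimately have "has_tangential_deriv q (monomial q j 2) 1 ((tangential_fps * (?B (1 + 1) - ?B (1 - 1))) $ j)"
    using has_tangential_deriv_cong [of "monomial q j 2" "\<lambda>x. Phi ?B x $ j"] by (simp only:)
  then have "tconst q j = (tangential_fps * (?B (1 + 1) - ?B (1 - 1))) $ j"
    unfolding tconst_def by (rule tangential_deriv_eq)
  also have "tangential_fps * (?B (1 + 1) - ?B (1 - 1)) = t_fps"
    by (simp add: t_fps_def mult_ac)
  finally show ?thesis .
qed

text \<open>The restriction to a cell is the dilated eigenfunction of \<open>cell_data\<close>,
  whose n-th coefficient carries the factor 5^(-n); this factor moves through the limit. The factor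
  3 clears the denominator of the cell scaling 5/3.\<close>

lemma cell_normal_deriv_Phi:
  assumes "\<And>x. x \<in> gasket q \<Longrightarrow> u x = Phi B x $ n"
  shows "3 * cell_normal_deriv q u [i] j =
    (5 * (dil (1/5) normal_fps * (2 * alpha_fps' * ext B i j - (ext B i (j + 1) + ext B i (j - 1))))) $ n"
proof -
  let ?D = "normal_fps * (2 * alpha_fps * cell_data B i j - (cell_data B i (j + 1) + cell_data B i (j - 1)))"
  have "has_normal_deriv q (\<lambda>x. Phi (cell_data B i) x $ n) j (?D $ n)"
    by (rule has_normal_deriv_Phi)
  then have "(\<lambda>m. (1/5) ^ n * ((5/3) ^ m * (2 * Phi (cell_data B i) (q j) $ n - Phi (cell_data B i) ((contr q j ^^ m) (q (j + 1))) $ n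
      - Phi (cell_data B i) ((contr q j ^^ m) (q (j - 1))) $ n))) \<longlonglongrightarrow> (1/5) ^ n * ?D $ n"
    unfolding has_normal_deriv_def by (intro tendsto_mult tendsto_const)
  moreover have "(1/5) ^ n * ((5/3) ^ m * (2 * a - b - c)) = (5/3) ^ m * (2 * ((1/5) ^ n * a) - (1/5) ^ n * b - (1/5) ^ n * c)"
    for a b c :: real and m
    by (simp add: algebra_simps)
  ultimately have "has_normal_deriv q (\<lambda>x. (1/5) ^ n * Phi (cell_data B i) x $ n) j ((1/5) ^ n * ?D $ n)"
    unfolding has_normal_deriv_def by (simp only:)
  then have "has_normal_deriv q (u \<circ> word_contr q [i]) j ((1/5) ^ n * ?D $ n)"
    by (subst has_normal_deriv_cong [where v = "\<lambda>x. (1/5) ^ n * Phi (cell_data B i) x $ n"]) (simp_all add: assms Phi_cell_data)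
  then have "cell_normal_deriv q u [i] j = 5/3 * ((1/5) ^ n * ?D $ n)"
    unfolding cell_normal_deriv_def using normal_deriv_eq by simp
  also have "(1/5) ^ n * ?D $ n = (dil (1/5) ?D) $ n"
    by (simp only: dil_nth)
  finally show ?thesis
    by (simp add: numeral_fps_const)
qed

lemma cell_tangential_deriv_Phi:
  assumes "\<And>x. x \<in> gasket q \<Longrightarrow> u x = Phi B x $ n"
  shows "cell_tangential_deriv q u [i] j = (5 * (dil (1/5) tangential_fps * (ext B i (j + 1) - ext B i (j - 1)))) $ n"
proof -
  let ?D = "tangential_fps * (cell_data B i (j + 1) - cell_data B i (j - 1))"
  have "has_tangential_deriv q (\<lambda>x. Phi (cell_data B i) x $ n) j (?D $ n)"
    by (rule has_tangential_deriv_Phi)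
  then have "(\<lambda>m. (1/5) ^ n * (5 ^ m * (Phi (cell_data B i) ((contr q j ^^ m) (q (j + 1))) $ n
      - Phi (cell_data B i) ((contr q j ^^ m) (q (j - 1))) $ n))) \<longlonglongrightarrow> (1/5) ^ n * ?D $ n"
    unfolding has_tangential_deriv_def by (intro tendsto_mult tendsto_const)
  moreover have "(1/5) ^ n * (5 ^ m * (b - c)) = 5 ^ m * ((1/5) ^ n * b - (1/5) ^ n * c)"
    for b c :: real and m
    by (simp add: algebra_simps)
  ultimately have "has_tangential_deriv q (\<lambda>x. (1/5) ^ n * Phi (cell_data B i) x $ n) j ((1/5) ^ n * ?D $ n)"
    unfolding has_tangential_deriv_def by (simp only:)
  then have "has_tangential_deriv q (u \<circ> word_contr q [i]) j ((1/5) ^ n * ?D $ n)"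
    by (subst has_tangential_deriv_cong [where v = "\<lambda>x. (1/5) ^ n * Phi (cell_data B i) x $ n"]) (simp_all add: assms Phi_cell_data)
  then have "cell_tangential_deriv q u [i] j = 5 * ((1/5) ^ n * ?D $ n)"
    unfolding cell_tangential_deriv_def using tangential_deriv_eq by simp
  also have "(1/5) ^ n * ?D $ n = (dil (1/5) ?D) $ n"
    by (simp only: dil_nth)
  finally show ?thesis
    by (simp add: numeral_fps_const)
qed

text \<open>With a = B 0 and b = B 1, the tangential differences add up to -4 \<alpha>'
  \<open>ext_p\<close> (a - b), and the normal defect is -(2 \<alpha>' + 1) \<open>ext_p\<close> (a
  - b); the third corner value drops out of both. The quotient is the defining relation
  \<open>Y_fps\<close>.\<close>

lemma matching_series:
  "3 * (5 * (dil (1/5) tangential_fps * (ext B 0 (1 + 1) - ext B 0 (1 - 1))) + 5 * (dil (1/5) tangential_fps * (ext B 1 (0 + 1) - ext B 1 (0 - 1)))) =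
   Y_fps * (5 * (dil (1/5) normal_fps * (2 * alpha_fps' * ext B 0 1 - (ext B 0 (1 + 1) + ext B 0 (1 - 1)))))"
proof -
  have "B (0 - 1) = B (1 + 1)" "(0::3) - 1 = 1 + 1"
    by simp_all
  define a b c where "a = B 0" and "b = B 1" and "c = B (1 + 1)"
  have S: "(\<Sum>k\<in>UNIV. B k) = a + b + c"
    unfolding sum_three [of B 0] \<open>B (0 - 1) = B (1 + 1)\<close> a_def b_def c_def by (simp add: add.assoc)
  have 1: "ext B 0 1 = ext_p * (a + b) + ext_p * ext_q * (a + b + c)"
    "ext B 0 (1 + 1) = ext_p * (a + c) + ext_p * ext_q * (a + b + c)"
    "ext B 1 (1 + 1) = ext_p * (b + c) + ext_p * ext_q * (a + b + c)"
    "ext B 0 0 = a" "ext B 1 1 = b"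
    unfolding S [symmetric] by (simp_all add: ext_def a_def b_def c_def)
  have 2: "ext B 0 (1 - 1) = a" "ext B 1 (0 + 1) = b" "ext B 1 (0 - 1) = ext_p * (b + c) + ext_p * ext_q * (a + b + c)"
    using 1 \<open>(0::3) - 1 = 1 + 1\<close> by simp_all
  show ?thesis
    unfolding 2 1(1,2) using Y_fps ext_p ext_q by algebra
qed

text \<open>Applying the Laplacian l times lowers the coefficient index by l, so the sum over l is a
  Cauchy product: coefficient \<open>j\<close> of \<open>matching_series\<close>. The terms with l >
  j vanish, which makes the infinite series a finite sum.\<close>

lemma polynomial_matching:
  assumes "is_polynomial q u"
  shows "(\<lambda>l. Y_fps $ l * cell_normal_deriv q ((laplacian q ^^ l) u) [0] 1) sums
    (cell_tangential_deriv q u [0] 1 + cell_tangential_deriv q u [1] 0)"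
proof -
  obtain j where "u \<in> polyharmonic q j"
    using assms unfolding is_polynomial_def by blast
  from polyharmonic_eq_Phi [OF this] obtain B where B: "\<And>x. x \<in> gasket q \<Longrightarrow> u x = Phi B x $ j"
    by blast
  define R where "R = 5 * (dil (1/5) normal_fps * (2 * alpha_fps' * ext B 0 1 - (ext B 0 (1 + 1) + ext B 0 (1 - 1))))"
  have N: "3 * cell_normal_deriv q ((laplacian q ^^ l) u) [0] 1 = (if l \<le> j then R $ (j - l) else 0)" for l
  proof (cases "l \<le> j")
    case True
    have "3 * cell_normal_deriv q ((laplacian q ^^ l) u) [0] 1 = R $ (j - l)"
      unfolding R_def
      by (rule cell_normal_deriv_Phi) (simp add: laplacian_funpow_Phi [OF B] True)
    then show ?thesis using True by simp
  next
    \<comment> \<open>Here the iterated Laplacian is 0 on the gasket, so the formula for cells is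
      used with zero corner values.\<close>
    case False
    have "3 * cell_normal_deriv q ((laplacian q ^^ l) u) [0] 1 =
      (5 * (dil (1/5) normal_fps * (2 * alpha_fps' * ext (\<lambda>_. 0) 0 1 - (ext (\<lambda>_. 0) 0 (1 + 1) + ext (\<lambda>_. 0) 0 (1 - 1))))) $ 0"
      by (rule cell_normal_deriv_Phi) (simp add: laplacian_funpow_Phi [OF B] False Phi_def)
    then show ?thesis using False by (simp add: ext_def)
  qed
  have "(\<lambda>l. Y_fps $ l * cell_normal_deriv q ((laplacian q ^^ l) u) [0] 1) sums
      (\<Sum>l\<in>{0..j}. Y_fps $ l * cell_normal_deriv q ((laplacian q ^^ l) u) [0] 1)"
  proof (rule sums_finite)
    fix l assume "l \<notin> {0..j}"
    then have "\<not> l \<le> j" by simp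
    then have "3 * cell_normal_deriv q ((laplacian q ^^ l) u) [0] 1 = 0"
      by (simp only: N if_False)
    then show "Y_fps $ l * cell_normal_deriv q ((laplacian q ^^ l) u) [0] 1 = 0"
      by simp
  qed simp
  moreover have "3 * (\<Sum>l\<in>{0..j}. Y_fps $ l * cell_normal_deriv q ((laplacian q ^^ l) u) [0] 1) =
      3 * (cell_tangential_deriv q u [0] 1 + cell_tangential_deriv q u [1] 0)"
  proof -
    have "3 * (\<Sum>l\<in>{0..j}. Y_fps $ l * cell_normal_deriv q ((laplacian q ^^ l) u) [0] 1) =
        (\<Sum>l\<in>{0..j}. Y_fps $ l * (3 * cell_normal_deriv q ((laplacian q ^^ l) u) [0] 1))"
      unfolding sum_distrib_left by (intro sum.cong refl) (rule mult.left_commute)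
    also have "\<dots> = (Y_fps * R) $ j"
      unfolding N fps_mult_nth by (intro sum.cong refl) simp
    also have "Y_fps * R = 3 * (5 * (dil (1/5) tangential_fps * (ext B 0 (1 + 1) - ext B 0 (1 - 1))) + 5 * (dil (1/5) tangential_fps * (ext B 1 (0 + 1) - ext B 1 (0 - 1))))"
      unfolding R_def by (rule matching_series [symmetric])
    also have "\<dots> $ j = 3 * (cell_tangential_deriv q u [0] 1 + cell_tangential_deriv q u [1] 0)"
    proof -
      have "cell_tangential_deriv q u [i] k = (5 * (dil (1/5) tangential_fps * (ext B i (k + 1) - ext B i (k - 1)))) $ j" for i k
        by (rule cell_tangential_deriv_Phi) (rule B)
      then show ?thesis
        by (simp only: numeral_fps_const fps_mult_left_const_nth fps_add_nth)
    qed
    finally show ?thesis .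
  qed
  then have "(\<Sum>l\<in>{0..j}. Y_fps $ l * cell_normal_deriv q ((laplacian q ^^ l) u) [0] 1) =
      cell_tangential_deriv q u [0] 1 + cell_tangential_deriv q u [1] 0"
    by (subst (asm) mult_cancel_left) simp
  ultimately show ?thesis by (simp only:)
qed

end

theorem lemma5p1:
  fixes q :: "3 \<Rightarrow> real^2" and Y :: "nat \<Rightarrow> real" and u :: "real^2 \<Rightarrow> real"
  assumes "equilateral q"
    and "Y 0 = 4"
    and "\<And>j. j \<ge> 1 \<Longrightarrow> Y j =
      - alpha q j
      - 18 * (\<Sum>l=0..j. nconst q (j + 1 - l) * (tconst q l / 5^l))
      + (\<Sum>l=0..<j. Y l *
          ((3/2 - 5 powi (int l - int j) / 2) * nconst q (j - l + 1)
           + (\<Sum>k=0..j-l. 5 * alpha q (j + 1 - l - k) * nconst q k * 5 powi (- int k)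
                         - 3 * nconst q (j + 1 - l - k) * alpha q k * 5 powi (- int k))))"
    and "is_polynomial q u"
  shows "(\<lambda>l. Y l * cell_normal_deriv q ((laplacian q ^^ l) u) [0] 1) sums
           (cell_tangential_deriv q u [0] 1 + cell_tangential_deriv q u [1] 0)"
proof -
  interpret equilateral_triangle q
    by unfold_locales (rule assms(1))
  have powi: "(5::real) powi (- int k) = (1/5) ^ k" for k
    by (simp add: power_int_minus power_one_over inverse_eq_divide)
  \<comment> \<open>Both sequences start with 4 and obey the same course-of-values recursion, once
    the constants are read as coefficients of their generating functions.\<close>
  have "Y j = Y_fps $ j" for j
  proof (induction j rule: less_induct)
    case (less j)
    show ?case
    proof (cases "j = 0")
      case True
      then show ?thesis by (simp add: assms(2) Y_fps_0)
    next
      case False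
      have "Y j = - alpha_fps $ j - 18 * (\<Sum>l=0..j. n_fps $ (j + 1 - l) * (t_fps $ l / 5 ^ l)) +
        (\<Sum>l=0..<j. Y l *
          ((3/2 - 5 powi (int l - int j) / 2) * n_fps $ (j - l + 1)
           + (\<Sum>k=0..j-l. 5 * alpha_fps $ (j + 1 - l - k) * n_fps $ k * 5 powi (- int k)
                         - 3 * n_fps $ (j + 1 - l - k) * alpha_fps $ k * 5 powi (- int k))))"
        using assms(3) [of j] False unfolding alpha_eq nconst_eq tconst_eq by simp
      also have "(\<Sum>l=0..<j. Y l *
          ((3/2 - 5 powi (int l - int j) / 2) * n_fps $ (j - l + 1)
           + (\<Sum>k=0..j-l. 5 * alpha_fps $ (j + 1 - l - k) * n_fps $ k * 5 powi (- int k)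
                         - 3 * n_fps $ (j + 1 - l - k) * alpha_fps $ k * 5 powi (- int k)))) =
          (\<Sum>l=0..<j. Y_fps $ l * (Z_fps $ (j - l + 1) / 2))"
      proof (rule sum.cong [OF refl])
        fix l assume "l \<in> {0..<j}"
        then have l: "l < j" by simp
        \<comment> \<open>Since l < j, integer and natural subtraction agree here, and the bracket
          takes the form of \<open>Z_fps_nth\<close> with n = j - l.\<close>
        have 1: "int l - int j = - int (j - l)" using l by simp
        have 2: "j + 1 - l - k = (j - l) + 1 - k" for k using l by simp
        show "Y l *
          ((3/2 - 5 powi (int l - int j) / 2) * n_fps $ (j - l + 1)
           + (\<Sum>k=0..j-l. 5 * alpha_fps $ (j + 1 - l - k) * n_fps $ k * 5 powi (- int k)
                         - 3 * n_fps $ (j + 1 - l - k) * alpha_fps $ k * 5 powi (- int k))) =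
          Y_fps $ l * (Z_fps $ (j - l + 1) / 2)"
          unfolding 1 2 powi less [OF l] using l by (subst Z_fps_nth) simp_all
      qed
      also have "- alpha_fps $ j - 18 * (\<Sum>l=0..j. n_fps $ (j + 1 - l) * (t_fps $ l / 5 ^ l)) + \<dots> = Y_fps $ j"
        using False by (intro Y_fps_rec [symmetric]) simp
      finally show ?thesis .
    qed
  qed
  then show ?thesis
    using polynomial_matching [OF assms(4)] by (simp only:)
qed

end
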